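(* Let $f:\mathfrak{g}\twoheadrightarrow\mathfrak{q}$ be a $\mathrm{Lie}$-central extension of Leibniz algebras over $\mathbb{K}$ with $\mathfrak{n}=\ker(f)$. The following statements are equivalent: (a) $f:\mathfrak{g}\twoheadrightarrow\mathfrak{q}$ is a $\mathrm{Lie}$-stem cover. (b) $\theta^{*}(\mathfrak{g}):HL^{\mathrm{Lie}}_2(\mathfrak{q})\to\mathfrak{n}$ is an isomorphism.
   Context: $\mathbb{K}$ is a field with $\frac12\in\mathbb{K}$. A Leibniz algebra is a $\mathbb{K}$-vector space $\mathfrak{q}$ with a bilinear bracket satisfying $[x,[y,z]]=[[x,y],z]-[[x,z],y]$. $\mathfrak{q}^{\mathrm{ann}}$ is the span of all $[x,x]$, $x\in\mathfrak{q}$ (a two-sided ideal), and $\mathfrak{q}_{\mathrm{Lie}}=\mathfrak{q}/\mathfrak{q}^{\mathrm{ann}}$. For two-sided ideals $\mathfrak{m},\mathfrak{n}$ of $\mathfrak{q}$, $[\mathfrak{m},\mathfrak{n}]_{\mathrm{Lie}}$ is the span of all $[m,n]+[n,m]$, $m\in\mathfrak{m}$, $n\in\mathfrak{n}$. An extension is a surjective homomorphism $f:\mathfrak{g}\twoheadrightarrow\mathfrak{q}$ of Leibniz algebras; with $\mathfrak{n}=\ker f$ it is $\mathrm{Lie}$-central if $[\mathfrak{n},\mathfrak{g}]_{\mathrm{Lie}}=0$. A $\mathrm{Lie}$-central extension is a $\mathrm{Lie}$-stem cover if the map $\mathfrak{g}_{\mathrm{Lie}}\to\mathfrak{q}_{\mathrm{Lie}}$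 induced by $f$ is an isomorphism and the induced map $HL^{\mathrm{Lie}}_2(\mathfrak{g})\to HL^{\mathrm{Lie}}_2(\mathfrak{q})$ is zero. For a free presentation $0\to\mathfrak{r}\to\mathfrak{f}\stackrel{\rho}{\to}\mathfrak{g}\to0$ ($\mathfrak{f}$ a free Leibniz algebra), $HL^{\mathrm{Lie}}_2(\mathfrak{g})=(\mathfrak{r}\cap[\mathfrak{f},\mathfrak{f}]_{\mathrm{Lie}})/[\mathfrak{r},\mathfrak{f}]_{\mathrm{Lie}}$ (independent of the presentation up to canonical isomorphism). Given a $\mathrm{Lie}$-central extension $f:\mathfrak{g}\twoheadrightarrow\mathfrak{q}$ with kernel $\mathfrak{n}$, use the free presentation $0\to\mathfrak{s}\to\mathfrak{f}\stackrel{f\circ\rho}{\to}\mathfrak{q}\to0$ of $\mathfrak{q}$: the map $HL^{\mathrm{Lie}}_2(\mathfrak{g})\to HL^{\mathrm{Lie}}_2(\mathfrak{q})$ is induced by $\mathfrak{r}\subseteq\mathfrak{s}$, and $\theta^{*}(\mathfrak{g}):HL^{\mathrm{Lie}}_2(\mathfrak{q})=(\mathfrak{s}\cap[\mathfrak{f},\mathfrak{f}]_{\mathrm{Lie}})/[\mathfrak{s},\mathfrak{f}]_{\mathrm{Lie}}\to\mathfrak{n}$ is induced by $\rho$. *)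

theory Defs
  imports "HOL-Algebra.Module" "HOL-Algebra.QuotRing"
begin

section \<open>Leibniz algebras\<close>

text \<open>
  Algebras over a field are carried by the record type of modules. Its multiplication field holds
  the bracket, so \<open>x \<otimes> y\<close> stands for \<open>[x, y]\<close>; the field \<open>one\<close> is never used.
\<close>

locale nonassoc_algebra = module K L for K (structure) and L (structure) +
  assumes bracket_closed [simp, intro]:
      "\<lbrakk>x \<in> carrier L; y \<in> carrier L\<rbrakk> \<Longrightarrow> x \<otimes>\<^bsub>L\<^esub> y \<in> carrier L"
    and bracket_add_left:
      "\<lbrakk>x \<in> carrier L; y \<in> carrier L; z \<in> carrier L\<rbrakk> \<Longrightarrow>
        (x \<oplus>\<^bsub>L\<^esub> y) \<otimes>\<^bsub>L\<^esub> z = x \<otimes>\<^bsub>L\<^esub> z \<oplus>\<^bsub>L\<^esub> y \<otimes>\<^bsub>L\<^esub> z"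
    and bracket_add_right:
      "\<lbrakk>x \<in> carrier L; y \<in> carrier L; z \<in> carrier L\<rbrakk> \<Longrightarrow>
        z \<otimes>\<^bsub>L\<^esub> (x \<oplus>\<^bsub>L\<^esub> y) = z \<otimes>\<^bsub>L\<^esub> x \<oplus>\<^bsub>L\<^esub> z \<otimes>\<^bsub>L\<^esub> y"
    and bracket_smult_left:
      "\<lbrakk>c \<in> carrier K; x \<in> carrier L; y \<in> carrier L\<rbrakk> \<Longrightarrow>
        (c \<odot>\<^bsub>L\<^esub> x) \<otimes>\<^bsub>L\<^esub> y = c \<odot>\<^bsub>L\<^esub> (x \<otimes>\<^bsub>L\<^esub> y)"
    and bracket_smult_right:
      "\<lbrakk>c \<in> carrier K; x \<in> carrier L; y \<in> carrier L\<rbrakk> \<Longrightarrow>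
        x \<otimes>\<^bsub>L\<^esub> (c \<odot>\<^bsub>L\<^esub> y) = c \<odot>\<^bsub>L\<^esub> (x \<otimes>\<^bsub>L\<^esub> y)"

locale leibniz_algebra = nonassoc_algebra K L + field K for K (structure) and L (structure) +
  assumes leibniz:
      "\<lbrakk>x \<in> carrier L; y \<in> carrier L; z \<in> carrier L\<rbrakk> \<Longrightarrow>
        x \<otimes>\<^bsub>L\<^esub> (y \<otimes>\<^bsub>L\<^esub> z) = (x \<otimes>\<^bsub>L\<^esub> y) \<otimes>\<^bsub>L\<^esub> z \<ominus>\<^bsub>L\<^esub> (x \<otimes>\<^bsub>L\<^esub> z) \<otimes>\<^bsub>L\<^esub> y"

definition algebra_hom ::
  "('k, 'c) ring_scheme \<Rightarrow> ('k, 'a, 'm) module_scheme \<Rightarrow> ('k, 'b, 'n) module_scheme \<Rightarrow> ('a \<Rightarrow> 'b) set"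
  where "algebra_hom K L M =
    {h \<in> carrier L \<rightarrow> carrier M.
      (\<forall>x\<in>carrier L. \<forall>y\<in>carrier L. h (x \<oplus>\<^bsub>L\<^esub> y) = h x \<oplus>\<^bsub>M\<^esub> h y) \<and>
      (\<forall>c\<in>carrier K. \<forall>x\<in>carrier L. h (c \<odot>\<^bsub>L\<^esub> x) = c \<odot>\<^bsub>M\<^esub> h x) \<and>
      (\<forall>x\<in>carrier L. \<forall>y\<in>carrier L. h (x \<otimes>\<^bsub>L\<^esub> y) = h x \<otimes>\<^bsub>M\<^esub> h y)}"

definition algebra_iso ::
  "('k, 'c) ring_scheme \<Rightarrow> ('k, 'a, 'm) module_scheme \<Rightarrow> ('k, 'b, 'n) module_scheme \<Rightarrow> ('a \<Rightarrow> 'b) set"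
  where "algebra_iso K L M = {h \<in> algebra_hom K L M. bij_betw h (carrier L) (carrier M)}"

definition lin_span ::
  "('k, 'c) ring_scheme \<Rightarrow> ('k, 'a, 'm) module_scheme \<Rightarrow> 'a set \<Rightarrow> 'a set"
  where "lin_span K L S = \<Inter> {H. submodule H K L \<and> S \<subseteq> H}"

definition two_sided_ideal ::
  "'a set \<Rightarrow> ('k, 'c) ring_scheme \<Rightarrow> ('k, 'a, 'm) module_scheme \<Rightarrow> bool"
  where "two_sided_ideal I K L \<longleftrightarrow> submodule I K L \<and>
    (\<forall>x\<in>carrier L. \<forall>i\<in>I. x \<otimes>\<^bsub>L\<^esub> i \<in> I \<and> i \<otimes>\<^bsub>L\<^esub> x \<in> I)"

definition quot_algebra :: "('k, 'a, 'm) module_scheme \<Rightarrow> 'a set \<Rightarrow> ('k, 'a set) module"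
  where "quot_algebra L I =
    \<lparr>carrier = a_rcosets\<^bsub>L\<^esub> I, mult = rcoset_mult L I, one = I +>\<^bsub>L\<^esub> \<one>\<^bsub>L\<^esub>,
     zero = I, add = set_add L, smult = (\<lambda>c A. \<Union>a\<in>A. I +>\<^bsub>L\<^esub> (c \<odot>\<^bsub>L\<^esub> a))\<rparr>"

text \<open>
  The map into a quotient by \<open>J\<close> of \<open>M\<close> induced by \<open>h\<close>: when \<open>h\<close> respects the cosets involved, all
  members of the union are the same coset.
\<close>

definition coset_map :: "('k, 'b, 'm) module_scheme \<Rightarrow> 'b set \<Rightarrow> ('a \<Rightarrow> 'b) \<Rightarrow> 'a set \<Rightarrow> 'b set"
  where "coset_map M J h A = (\<Union>a\<in>A. J +>\<^bsub>M\<^esub> h a)"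


section \<open>Free Leibniz algebras\<close>

datatype 'x magma = Gen 'x | Prod "'x magma" "'x magma"

text \<open>
  The free nonassociative algebra on \<open>X\<close>: finitely supported functions on the free magma on \<open>X\<close>.
  The value at \<open>Prod l r\<close> of a product has a single contribution, since \<open>Prod\<close> is injective.
\<close>

definition magma_algebra :: "('k, 'c) ring_scheme \<Rightarrow> 'x set \<Rightarrow> ('k, 'x magma \<Rightarrow> 'k) module"
  where "magma_algebra K X =
    \<lparr>carrier = {p. (\<forall>t. p t \<in> carrier K) \<and> finite {t. p t \<noteq> \<zero>\<^bsub>K\<^esub>} \<and>
                   (\<forall>t. p t \<noteq> \<zero>\<^bsub>K\<^esub> \<longrightarrow> set_magma t \<subseteq> X)},
     mult = (\<lambda>p q t. case t of Gen x \<Rightarrow> \<zero>\<^bsub>K\<^esub> | Prod l r \<Rightarrow> p l \<otimes>\<^bsub>K\<^esub> q r),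
     one = (\<lambda>t. \<zero>\<^bsub>K\<^esub>),
     zero = (\<lambda>t. \<zero>\<^bsub>K\<^esub>),
     add = (\<lambda>p q t. p t \<oplus>\<^bsub>K\<^esub> q t),
     smult = (\<lambda>c p t. c \<otimes>\<^bsub>K\<^esub> p t)\<rparr>"

definition magma_elem :: "('k, 'c) ring_scheme \<Rightarrow> 'x magma \<Rightarrow> 'x magma \<Rightarrow> 'k"
  where "magma_elem K s = (\<lambda>t. if t = s then \<one>\<^bsub>K\<^esub> else \<zero>\<^bsub>K\<^esub>)"

definition leibniz_ideal ::
  "('k, 'c) ring_scheme \<Rightarrow> ('k, 'a, 'm) module_scheme \<Rightarrow> 'a set"
  where "leibniz_ideal K A = \<Inter> {I. two_sided_ideal I K A \<and>
    (\<forall>x\<in>carrier A. \<forall>y\<in>carrier A. \<forall>z\<in>carrier A.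
      x \<otimes>\<^bsub>A\<^esub> (y \<otimes>\<^bsub>A\<^esub> z) \<ominus>\<^bsub>A\<^esub> ((x \<otimes>\<^bsub>A\<^esub> y) \<otimes>\<^bsub>A\<^esub> z \<ominus>\<^bsub>A\<^esub> (x \<otimes>\<^bsub>A\<^esub> z) \<otimes>\<^bsub>A\<^esub> y) \<in> I)}"

definition free_leibniz :: "('k, 'c) ring_scheme \<Rightarrow> 'x set \<Rightarrow> ('k, ('x magma \<Rightarrow> 'k) set) module"
  where "free_leibniz K X =
    quot_algebra (magma_algebra K X) (leibniz_ideal K (magma_algebra K X))"

definition free_gen :: "('k, 'c) ring_scheme \<Rightarrow> 'x set \<Rightarrow> 'x \<Rightarrow> ('x magma \<Rightarrow> 'k) set"
  where "free_gen K X x =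
    leibniz_ideal K (magma_algebra K X) +>\<^bsub>magma_algebra K X\<^esub> magma_elem K (Gen x)"

text \<open>
  A universal property cannot quantify over Leibniz algebras of all types, so freeness on a basis
  \<open>B\<close> is expressed by the model \<^const>\<open>free_leibniz\<close>. The universal property, for
  targets of an arbitrary type, is the theorem \<open>free_on_universal\<close> below.
\<close>

definition free_on :: "('k, 'c) ring_scheme \<Rightarrow> ('k, 'f, 'm) module_scheme \<Rightarrow> 'f set \<Rightarrow> bool"
  where "free_on K F B \<longleftrightarrow> leibniz_algebra K F \<and> B \<subseteq> carrier F \<and>
    (\<exists>\<phi>\<in>algebra_iso K (free_leibniz K B) F. \<forall>b\<in>B. \<phi> (free_gen K B b) = b)"


section \<open>Notions relative to Lie algebras\<close>

definition leibniz_ann :: "('k, 'c) ring_scheme \<Rightarrow> ('k, 'a, 'm) module_scheme \<Rightarrow> 'a set"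
  where "leibniz_ann K L = lin_span K L {x \<otimes>\<^bsub>L\<^esub> x | x. x \<in> carrier L}"

definition liezation :: "('k, 'c) ring_scheme \<Rightarrow> ('k, 'a, 'm) module_scheme \<Rightarrow> ('k, 'a set) module"
  where "liezation K L = quot_algebra L (leibniz_ann K L)"

definition lie_comm ::
  "('k, 'c) ring_scheme \<Rightarrow> ('k, 'a, 'm) module_scheme \<Rightarrow> 'a set \<Rightarrow> 'a set \<Rightarrow> 'a set"
  where "lie_comm K L M N =
    lin_span K L {m \<otimes>\<^bsub>L\<^esub> n \<oplus>\<^bsub>L\<^esub> n \<otimes>\<^bsub>L\<^esub> m | m n. m \<in> M \<and> n \<in> N}"

definition leibniz_extension ::
  "('k, 'c) ring_scheme \<Rightarrow> ('k, 'a, 'm) module_scheme \<Rightarrow> ('k, 'b, 'n) module_scheme \<Rightarrow> ('a \<Rightarrow> 'b) \<Rightarrow> bool"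
  where "leibniz_extension K G Q f \<longleftrightarrow> leibniz_algebra K G \<and> leibniz_algebra K Q \<and>
    f \<in> algebra_hom K G Q \<and> f ` carrier G = carrier Q"

definition lie_central_extension ::
  "('k, 'c) ring_scheme \<Rightarrow> ('k, 'a, 'm) module_scheme \<Rightarrow> ('k, 'b, 'n) module_scheme \<Rightarrow> ('a \<Rightarrow> 'b) \<Rightarrow> bool"
  where "lie_central_extension K G Q f \<longleftrightarrow> leibniz_extension K G Q f \<and>
    lie_comm K G (a_kernel G Q f) (carrier G) = {\<zero>\<^bsub>G\<^esub>}"

definition free_presentation ::
  "('k, 'c) ring_scheme \<Rightarrow> ('k, 'f, 'm) module_scheme \<Rightarrow> ('k, 'a, 'n) module_scheme \<Rightarrow> ('f \<Rightarrow> 'a) \<Rightarrow> bool"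
  where "free_presentation K F G \<rho> \<longleftrightarrow> leibniz_extension K F G \<rho> \<and> (\<exists>B. free_on K F B)"

text \<open>\<open>HL2_Lie K F G \<rho>\<close> is the second homology of \<open>G\<close>, computed from the free presentation
  \<open>\<rho>\<close> of \<open>G\<close> by \<open>F\<close>.\<close>

definition HL2_Lie ::
  "('k, 'c) ring_scheme \<Rightarrow> ('k, 'f, 'm) module_scheme \<Rightarrow> ('k, 'a, 'n) module_scheme \<Rightarrow> ('f \<Rightarrow> 'a) \<Rightarrow>
    ('k, 'f set) module"
  where "HL2_Lie K F G \<rho> =
    quot_algebra (F\<lparr>carrier := a_kernel F G \<rho> \<inter> lie_comm K F (carrier F) (carrier F)\<rparr>)
      (lie_comm K F (a_kernel F G \<rho>) (carrier F))"

text \<open>For a free presentation \<open>\<rho>\<close> of \<open>G\<close> by \<open>F\<close>, the homology of \<open>Q\<close> is computed from the free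
  presentation \<open>f \<circ> \<rho>\<close>; the map from the homology of \<open>G\<close> is induced by the inclusion of kernels.\<close>

definition HL2_Lie_map ::
  "('k, 'c) ring_scheme \<Rightarrow> ('k, 'f, 'm) module_scheme \<Rightarrow> ('f \<Rightarrow> 'a) \<Rightarrow> ('k, 'b, 'n) module_scheme \<Rightarrow>
    ('a \<Rightarrow> 'b) \<Rightarrow> 'f set \<Rightarrow> 'f set"
  where "HL2_Lie_map K F \<rho> Q f =
    coset_map F (lie_comm K F (a_kernel F Q (f \<circ> \<rho>)) (carrier F)) (\<lambda>x. x)"

definition lie_stem_cover ::
  "('k, 'c) ring_scheme \<Rightarrow> ('k, 'f, 'l) module_scheme \<Rightarrow> ('f \<Rightarrow> 'a) \<Rightarrow> ('k, 'a, 'm) module_scheme \<Rightarrow>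
    ('k, 'b, 'n) module_scheme \<Rightarrow> ('a \<Rightarrow> 'b) \<Rightarrow> bool"
  where "lie_stem_cover K F \<rho> G Q f \<longleftrightarrow> lie_central_extension K G Q f \<and>
    coset_map Q (leibniz_ann K Q) f \<in> algebra_iso K (liezation K G) (liezation K Q) \<and>
    (\<forall>A\<in>carrier (HL2_Lie K F G \<rho>). HL2_Lie_map K F \<rho> Q f A = \<zero>\<^bsub>HL2_Lie K F Q (f \<circ> \<rho>)\<^esub>)"

text \<open>For a Lie-central extension, \<open>\<rho>\<close> is constant on each coset \<open>A\<close> in the homology of \<open>Q\<close>, so that
  its image is a singleton.\<close>

definition theta_star :: "('f \<Rightarrow> 'a) \<Rightarrow> 'f set \<Rightarrow> 'a"
  where "theta_star \<rho> A = the_elem (\<rho> ` A)"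


section \<open>Universal property and existence of free presentations\<close>

lemma magma_algebra_nonassoc:
  assumes "cring K" shows "nonassoc_algebra K (magma_algebra K X)"
proof -
  interpret cring K by fact
  have ab: "abelian_group (magma_algebra K X)"
  proof (rule abelian_groupI, goal_cases)
    case (1 p q)
    have "{t. p t \<oplus>\<^bsub>K\<^esub> q t \<noteq> \<zero>\<^bsub>K\<^esub>} \<subseteq> {t. p t \<noteq> \<zero>\<^bsub>K\<^esub>} \<union> {t. q t \<noteq> \<zero>\<^bsub>K\<^esub>}"
      by auto
    then have "finite {t. p t \<oplus>\<^bsub>K\<^esub> q t \<noteq> \<zero>\<^bsub>K\<^esub>}"
      using 1 by (auto simp: magma_algebra_def intro: finite_subset)
    then show ?case
      using 1 by (auto simp: magma_algebra_def) (metis add.l_one subsetD zero_closed)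
  next
    case (6 p)
    have "(\<lambda>t. \<ominus>\<^bsub>K\<^esub> p t) \<in> carrier (magma_algebra K X)"
      using 6 by (auto simp: magma_algebra_def)
    moreover have "(\<lambda>t. \<ominus>\<^bsub>K\<^esub> p t) \<oplus>\<^bsub>magma_algebra K X\<^esub> p = \<zero>\<^bsub>magma_algebra K X\<^esub>"
      using 6 by (auto simp: magma_algebra_def l_neg)
    ultimately show ?case by blast
  qed (auto simp: magma_algebra_def a_ac fun_eq_iff)
  have mod: "module K (magma_algebra K X)"
  proof (rule moduleI, goal_cases)
    case (3 c p)
    have "{t. c \<otimes>\<^bsub>K\<^esub> p t \<noteq> \<zero>\<^bsub>K\<^esub>} \<subseteq> {t. p t \<noteq> \<zero>\<^bsub>K\<^esub>}" using 3 by auto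
    then have "finite {t. c \<otimes>\<^bsub>K\<^esub> p t \<noteq> \<zero>\<^bsub>K\<^esub>}"
      using 3 by (auto simp: magma_algebra_def intro: finite_subset)
    then show ?case
      using 3 by (auto simp: magma_algebra_def) (metis r_null subsetD)
  qed (use ab assms in \<open>auto simp: magma_algebra_def l_distr r_distr m_assoc fun_eq_iff\<close>)
  show ?thesis
  proof (intro nonassoc_algebra.intro[OF mod] nonassoc_algebra_axioms.intro, goal_cases)
    case (1 p q)
    let ?r = "p \<otimes>\<^bsub>magma_algebra K X\<^esub> q"
    have r: "?r t = (case t of Gen x \<Rightarrow> \<zero>\<^bsub>K\<^esub> | Prod l r \<Rightarrow> p l \<otimes>\<^bsub>K\<^esub> q r)" for t
      by (simp add: magma_algebra_def)
    have pq: "p t \<in> carrier K" "q t \<in> carrier K" for t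
      using 1 by (auto simp: magma_algebra_def)
    have sub: "{t. ?r t \<noteq> \<zero>\<^bsub>K\<^esub>} \<subseteq> (\<lambda>(l, r). Prod l r) ` ({t. p t \<noteq> \<zero>\<^bsub>K\<^esub>} \<times> {t. q t \<noteq> \<zero>\<^bsub>K\<^esub>})"
    proof
      fix t assume "t \<in> {t. ?r t \<noteq> \<zero>\<^bsub>K\<^esub>}"
      then show "t \<in> (\<lambda>(l, r). Prod l r) ` ({t. p t \<noteq> \<zero>\<^bsub>K\<^esub>} \<times> {t. q t \<noteq> \<zero>\<^bsub>K\<^esub>})"
        using pq by (cases t) (auto simp: r)
    qed
    have "finite {t. ?r t \<noteq> \<zero>\<^bsub>K\<^esub>}"
      by (rule finite_subset[OF sub]) (use 1 in \<open>auto simp: magma_algebra_def\<close>)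
    moreover have "set_magma t \<subseteq> X" if nz: "?r t \<noteq> \<zero>\<^bsub>K\<^esub>" for t
    proof -
      obtain l r where "t = Prod l r" "p l \<noteq> \<zero>\<^bsub>K\<^esub>" "q r \<noteq> \<zero>\<^bsub>K\<^esub>"
        using subsetD[OF sub, of t] nz by auto
      moreover have "set_magma l \<subseteq> X" "set_magma r \<subseteq> X"
        using 1 calculation by (simp_all add: magma_algebra_def)
      ultimately show ?thesis by simp
    qed
    moreover have "?r t \<in> carrier K" for t
      using pq by (auto simp: r split: magma.splits)
    ultimately show ?case by (simp add: magma_algebra_def)
  qed (auto simp: magma_algebra_def fun_eq_iff l_distr r_distr m_ac split: magma.splits)
qed

lemma (in module) submodule_abelian_subgroup:
  "submodule I R M \<Longrightarrow> abelian_subgroup I M"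
  by (simp add: M.abelian_group_axioms abelian_subgroupI3 additive_subgroup_def submodule.axioms(1))

lemma (in abelian_subgroup) coset_add_mem:
  assumes "i \<in> H" "x \<in> carrier G" shows "H +> (i \<oplus> x) = H +> x"
  using a_coset_add_assoc[of H i x] a_rcos_const[of i] assms a_subset by auto

context nonassoc_algebra
begin

lemma zero_bracket [simp]: "x \<in> carrier L \<Longrightarrow> \<zero>\<^bsub>L\<^esub> \<otimes>\<^bsub>L\<^esub> x = \<zero>\<^bsub>L\<^esub>"
  using bracket_smult_left[of "\<zero>" x x] by simp

lemma bracket_zero [simp]: "x \<in> carrier L \<Longrightarrow> x \<otimes>\<^bsub>L\<^esub> \<zero>\<^bsub>L\<^esub> = \<zero>\<^bsub>L\<^esub>"
  using bracket_smult_right[of "\<zero>" x x] by simp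

lemma rcoset_bracket:
  assumes I: "two_sided_ideal I K L" and a: "a \<in> carrier L" and b: "b \<in> carrier L"
  shows "rcoset_mult L I (I +>\<^bsub>L\<^esub> a) (I +>\<^bsub>L\<^esub> b) = I +>\<^bsub>L\<^esub> (a \<otimes>\<^bsub>L\<^esub> b)"
proof -
  interpret I: abelian_subgroup I L
    using I submodule_abelian_subgroup by (auto simp: two_sided_ideal_def)
  note sub = I.a_subset
  have "I +>\<^bsub>L\<^esub> (x \<otimes>\<^bsub>L\<^esub> y) = I +>\<^bsub>L\<^esub> (a \<otimes>\<^bsub>L\<^esub> b)" if x: "x \<in> I +>\<^bsub>L\<^esub> a" and y: "y \<in> I +>\<^bsub>L\<^esub> b" for x y
  proof -
    obtain i where i: "i \<in> I" "x = i \<oplus>\<^bsub>L\<^esub> a" using x by (auto simp: a_r_coset_def')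
    obtain j where j: "j \<in> I" "y = j \<oplus>\<^bsub>L\<^esub> b" using y by (auto simp: a_r_coset_def')
    have c: "i \<in> carrier L" "j \<in> carrier L" using i j sub by auto
    have m: "i \<otimes>\<^bsub>L\<^esub> (j \<oplus>\<^bsub>L\<^esub> b) \<in> I" "a \<otimes>\<^bsub>L\<^esub> j \<in> I"
      using I i j a b c by (auto simp: two_sided_ideal_def)
    have "x \<otimes>\<^bsub>L\<^esub> y = i \<otimes>\<^bsub>L\<^esub> (j \<oplus>\<^bsub>L\<^esub> b) \<oplus>\<^bsub>L\<^esub> (a \<otimes>\<^bsub>L\<^esub> j \<oplus>\<^bsub>L\<^esub> a \<otimes>\<^bsub>L\<^esub> b)"
      using a b c by (simp add: i(2) j(2) bracket_add_left bracket_add_right M.a_ac)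
    then show ?thesis using m a b c by (simp add: I.coset_add_mem)
  qed
  moreover have "a \<in> I +>\<^bsub>L\<^esub> a" "b \<in> I +>\<^bsub>L\<^esub> b" using a b I.a_rcos_self by auto
  ultimately show ?thesis unfolding rcoset_mult_def by blast
qed

lemma rcoset_smult:
  assumes I: "two_sided_ideal I K L" and a: "a \<in> carrier L" and c: "c \<in> carrier K"
  shows "(\<Union>x\<in>I +>\<^bsub>L\<^esub> a. I +>\<^bsub>L\<^esub> (c \<odot>\<^bsub>L\<^esub> x)) = I +>\<^bsub>L\<^esub> (c \<odot>\<^bsub>L\<^esub> a)"
proof -
  interpret I: abelian_subgroup I L
    using I submodule_abelian_subgroup by (auto simp: two_sided_ideal_def)
  have "I +>\<^bsub>L\<^esub> (c \<odot>\<^bsub>L\<^esub> x) = I +>\<^bsub>L\<^esub> (c \<odot>\<^bsub>L\<^esub> a)" if x: "x \<in> I +>\<^bsub>L\<^esub> a" for x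
  proof -
    obtain i where i: "i \<in> I" "x = i \<oplus>\<^bsub>L\<^esub> a" using x by (auto simp: a_r_coset_def')
    have m: "c \<odot>\<^bsub>L\<^esub> i \<in> I" using I i c submoduleE(4) by (auto simp: two_sided_ideal_def)
    have "c \<odot>\<^bsub>L\<^esub> x = c \<odot>\<^bsub>L\<^esub> i \<oplus>\<^bsub>L\<^esub> c \<odot>\<^bsub>L\<^esub> a"
      using a c i I.a_subset by (auto simp: smult_r_distr)
    then show ?thesis using m a c by (simp add: I.coset_add_mem)
  qed
  moreover have "a \<in> I +>\<^bsub>L\<^esub> a" using a I.a_rcos_self by auto
  ultimately show ?thesis by blast
qed

lemma quot_algebra_simps:
  assumes "two_sided_ideal I K L"
  shows "carrier (quot_algebra L I) = (\<lambda>x. I +>\<^bsub>L\<^esub> x) ` carrier L"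
    and "\<zero>\<^bsub>quot_algebra L I\<^esub> = I +>\<^bsub>L\<^esub> \<zero>\<^bsub>L\<^esub>"
    and "\<lbrakk>x \<in> carrier L; y \<in> carrier L\<rbrakk> \<Longrightarrow>
      (I +>\<^bsub>L\<^esub> x) \<oplus>\<^bsub>quot_algebra L I\<^esub> (I +>\<^bsub>L\<^esub> y) = I +>\<^bsub>L\<^esub> (x \<oplus>\<^bsub>L\<^esub> y)"
    and "\<lbrakk>x \<in> carrier L; y \<in> carrier L\<rbrakk> \<Longrightarrow>
      (I +>\<^bsub>L\<^esub> x) \<otimes>\<^bsub>quot_algebra L I\<^esub> (I +>\<^bsub>L\<^esub> y) = I +>\<^bsub>L\<^esub> (x \<otimes>\<^bsub>L\<^esub> y)"
    and "\<lbrakk>c \<in> carrier K; x \<in> carrier L\<rbrakk> \<Longrightarrow>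
      c \<odot>\<^bsub>quot_algebra L I\<^esub> (I +>\<^bsub>L\<^esub> x) = I +>\<^bsub>L\<^esub> (c \<odot>\<^bsub>L\<^esub> x)"
proof -
  interpret I: abelian_subgroup I L
    using assms submodule_abelian_subgroup by (auto simp: two_sided_ideal_def)
  show "carrier (quot_algebra L I) = (\<lambda>x. I +>\<^bsub>L\<^esub> x) ` carrier L"
    by (auto simp: quot_algebra_def A_RCOSETS_def')
  show "\<zero>\<^bsub>quot_algebra L I\<^esub> = I +>\<^bsub>L\<^esub> \<zero>\<^bsub>L\<^esub>"
    using I.a_subset by (simp add: quot_algebra_def)
qed (simp_all add: quot_algebra_def rcoset_bracket rcoset_smult assms
      abelian_subgroup.a_rcos_sum[OF submodule_abelian_subgroup] assms[unfolded two_sided_ideal_def])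

lemma quot_nonassoc_algebra:
  assumes I: "two_sided_ideal I K L"
  shows "nonassoc_algebra K (quot_algebra L I)"
proof -
  note q = quot_algebra_simps[OF I]
  have ab: "abelian_group (quot_algebra L I)"
  proof (rule abelian_groupI, goal_cases)
    case (6 A)
    then obtain x where x: "x \<in> carrier L" "A = I +>\<^bsub>L\<^esub> x" by (auto simp: q)
    then have "(I +>\<^bsub>L\<^esub> (\<ominus>\<^bsub>L\<^esub> x)) \<oplus>\<^bsub>quot_algebra L I\<^esub> A = \<zero>\<^bsub>quot_algebra L I\<^esub>"
      by (simp add: q M.l_neg)
    then show ?case using x by (auto simp: q)
  qed (auto simp: q M.a_ac)
  have mod: "module K (quot_algebra L I)"
    by (rule moduleI) (auto simp: q ab R.is_cring smult_l_distr smult_r_distr smult_assoc1)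
  show ?thesis
    by (intro nonassoc_algebra.intro[OF mod] nonassoc_algebra_axioms.intro)
       (auto simp: q bracket_add_left bracket_add_right bracket_smult_left bracket_smult_right)
qed

lemma two_sided_ideal_Inter:
  assumes "\<And>I. I \<in> S \<Longrightarrow> two_sided_ideal I K L" "S \<noteq> {}"
  shows "two_sided_ideal (\<Inter>S) K L"
  unfolding two_sided_ideal_def
proof (intro conjI submoduleI)
  note s = submoduleE[OF conjunct1[OF assms(1)[unfolded two_sided_ideal_def]]]
  show "\<Inter>S \<subseteq> carrier L" using s(1) assms(2) by blast
  show "\<zero>\<^bsub>L\<^esub> \<in> \<Inter>S"
    using assms(1) submodule_abelian_subgroup
    by (auto simp: two_sided_ideal_def abelian_subgroup_def intro: additive_subgroup.zero_closed)
qed (use assms submoduleE(3-5) in \<open>auto simp: two_sided_ideal_def\<close>)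

lemma carrier_two_sided_ideal: "two_sided_ideal (carrier L) K L"
  by (simp add: two_sided_ideal_def carrier_is_submodule)

lemma leibniz_ideal:
  shows "two_sided_ideal (leibniz_ideal K L) K L"
    and "\<lbrakk>x \<in> carrier L; y \<in> carrier L; z \<in> carrier L\<rbrakk> \<Longrightarrow>
      x \<otimes>\<^bsub>L\<^esub> (y \<otimes>\<^bsub>L\<^esub> z) \<ominus>\<^bsub>L\<^esub> ((x \<otimes>\<^bsub>L\<^esub> y) \<otimes>\<^bsub>L\<^esub> z \<ominus>\<^bsub>L\<^esub> (x \<otimes>\<^bsub>L\<^esub> z) \<otimes>\<^bsub>L\<^esub> y)
        \<in> leibniz_ideal K L"
  unfolding leibniz_ideal_def
  by (rule two_sided_ideal_Inter, use carrier_two_sided_ideal in auto)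

lemma quot_leibniz_algebra:
  assumes "field K"
  shows "leibniz_algebra K (quot_algebra L (leibniz_ideal K L))"
proof -
  let ?I = "leibniz_ideal K L"
  let ?Q = "quot_algebra L ?I"
  note q = quot_algebra_simps[OF leibniz_ideal(1)]
  interpret Q: nonassoc_algebra K ?Q by (rule quot_nonassoc_algebra[OF leibniz_ideal(1)])
  interpret I: abelian_subgroup ?I L
    using leibniz_ideal(1) submodule_abelian_subgroup by (auto simp: two_sided_ideal_def)
  have minus: "\<ominus>\<^bsub>?Q\<^esub> (?I +>\<^bsub>L\<^esub> x) = ?I +>\<^bsub>L\<^esub> (\<ominus>\<^bsub>L\<^esub> x)" if "x \<in> carrier L" for x
    using that by (intro Q.M.minus_equality) (auto simp: q M.l_neg)
  show ?thesis
  proof (intro leibniz_algebra.intro leibniz_algebra_axioms.intro assms)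
    fix A B C assume "A \<in> carrier ?Q" "B \<in> carrier ?Q" "C \<in> carrier ?Q"
    then obtain x y z where xyz: "x \<in> carrier L" "y \<in> carrier L" "z \<in> carrier L"
      and ABC: "A = ?I +>\<^bsub>L\<^esub> x" "B = ?I +>\<^bsub>L\<^esub> y" "C = ?I +>\<^bsub>L\<^esub> z"
      by (auto simp: q)
    let ?a = "x \<otimes>\<^bsub>L\<^esub> (y \<otimes>\<^bsub>L\<^esub> z)"
    let ?b = "(x \<otimes>\<^bsub>L\<^esub> y) \<otimes>\<^bsub>L\<^esub> z \<ominus>\<^bsub>L\<^esub> (x \<otimes>\<^bsub>L\<^esub> z) \<otimes>\<^bsub>L\<^esub> y"
    have "?I +>\<^bsub>L\<^esub> ?a = ?I +>\<^bsub>L\<^esub> ((?a \<ominus>\<^bsub>L\<^esub> ?b) \<oplus>\<^bsub>L\<^esub> ?b)"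
      using xyz by (simp add: a_minus_def M.a_assoc M.l_neg)
    also have "\<dots> = ?I +>\<^bsub>L\<^esub> ?b"
      using leibniz_ideal(2)[of x y z] xyz by (intro I.coset_add_mem) auto
    finally show "A \<otimes>\<^bsub>?Q\<^esub> (B \<otimes>\<^bsub>?Q\<^esub> C) =
        (A \<otimes>\<^bsub>?Q\<^esub> B) \<otimes>\<^bsub>?Q\<^esub> C \<ominus>\<^bsub>?Q\<^esub> (A \<otimes>\<^bsub>?Q\<^esub> C) \<otimes>\<^bsub>?Q\<^esub> B"
      using xyz by (simp add: ABC q a_minus_def minus)
  qed (rule Q.nonassoc_algebra_axioms)
qed

end

lemma free_leibniz_algebra:
  assumes "field K" shows "leibniz_algebra K (free_leibniz K X)"
proof -
  interpret field K by fact
  show ?thesis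
    unfolding free_leibniz_def
    by (rule nonassoc_algebra.quot_leibniz_algebra[OF magma_algebra_nonassoc[OF is_cring] assms])
qed

lemma magma_algebra_simps:
  "\<zero>\<^bsub>magma_algebra K X\<^esub> = (\<lambda>t. \<zero>\<^bsub>K\<^esub>)"
  "p \<oplus>\<^bsub>magma_algebra K X\<^esub> q = (\<lambda>t. p t \<oplus>\<^bsub>K\<^esub> q t)"
  "c \<odot>\<^bsub>magma_algebra K X\<^esub> p = (\<lambda>t. c \<otimes>\<^bsub>K\<^esub> p t)"
  by (simp_all add: magma_algebra_def)

lemma magma_elem_closed:
  assumes "field K" "set_magma t \<subseteq> X" shows "magma_elem K t \<in> carrier (magma_algebra K X)"
proof -
  interpret field K by fact
  have "finite {s. magma_elem K t s \<noteq> \<zero>\<^bsub>K\<^esub>}"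
    by (rule finite_subset[of _ "{t}"]) (auto simp: magma_elem_def)
  then show ?thesis using assms by (auto simp: magma_algebra_def magma_elem_def)
qed

lemma magma_elem_Prod:
  assumes "field K"
  shows "magma_elem K s \<otimes>\<^bsub>magma_algebra K X\<^esub> magma_elem K t = magma_elem K (Prod s t)"
proof -
  interpret field K by fact
  show ?thesis by (auto simp: magma_algebra_def magma_elem_def fun_eq_iff split: magma.splits)
qed

lemma magma_algebra_induct:
  assumes K: "field K" and p: "p \<in> carrier (magma_algebra K X)"
    and zero: "P \<zero>\<^bsub>magma_algebra K X\<^esub>"
    and step: "\<And>c t p. \<lbrakk>c \<in> carrier K; set_magma t \<subseteq> X; p \<in> carrier (magma_algebra K X); P p\<rbrakk> \<Longrightarrow>
      P (c \<odot>\<^bsub>magma_algebra K X\<^esub> magma_elem K t \<oplus>\<^bsub>magma_algebra K X\<^esub> p)"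
  shows "P p"
proof -
  interpret field K by fact
  have "finite T \<Longrightarrow> p \<in> carrier (magma_algebra K X) \<Longrightarrow> {t. p t \<noteq> \<zero>\<^bsub>K\<^esub>} = T \<Longrightarrow> P p" for T p
  proof (induction T arbitrary: p rule: finite_induct)
    case empty
    then have "p = \<zero>\<^bsub>magma_algebra K X\<^esub>" by (auto simp: magma_algebra_def)
    then show ?case using zero by simp
  next
    case (insert t T)
    define q where "q = (\<lambda>s. if s = t then \<zero>\<^bsub>K\<^esub> else p s)"
    have pt: "p s \<in> carrier K" "p t \<noteq> \<zero>\<^bsub>K\<^esub>" for s
      using insert by (auto simp: magma_algebra_def)
    have T: "{s. q s \<noteq> \<zero>\<^bsub>K\<^esub>} = T" using insert by (auto simp: q_def)
    have q: "q \<in> carrier (magma_algebra K X)"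
      using insert T by (auto simp: magma_algebra_def q_def)
    have t: "set_magma t \<subseteq> X" using insert.prems(1) pt by (simp add: magma_algebra_def)
    have "p = p t \<odot>\<^bsub>magma_algebra K X\<^esub> magma_elem K t \<oplus>\<^bsub>magma_algebra K X\<^esub> q"
      using pt by (auto simp: magma_algebra_simps magma_elem_def q_def)
    then show ?case using step[OF pt(1)[of t] t q insert.IH[OF q T]] by simp
  qed
  then show ?thesis using p by (auto simp: magma_algebra_def)
qed

primrec magma_val :: "('a, 'm) ring_scheme \<Rightarrow> ('x \<Rightarrow> 'a) \<Rightarrow> 'x magma \<Rightarrow> 'a" where
  "magma_val L h (Gen x) = h x"
| "magma_val L h (Prod s t) = magma_val L h s \<otimes>\<^bsub>L\<^esub> magma_val L h t"

definition magma_ev ::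
  "('k, 'c) ring_scheme \<Rightarrow> ('k, 'a, 'm) module_scheme \<Rightarrow> ('x \<Rightarrow> 'a) \<Rightarrow> ('x magma \<Rightarrow> 'k) \<Rightarrow> 'a"
  where "magma_ev K L h p = (\<Oplus>\<^bsub>L\<^esub>t\<in>{t. p t \<noteq> \<zero>\<^bsub>K\<^esub>}. p t \<odot>\<^bsub>L\<^esub> magma_val L h t)"

lemma algebra_homD:
  assumes "h \<in> algebra_hom K L M"
  shows "x \<in> carrier L \<Longrightarrow> h x \<in> carrier M"
    and "\<lbrakk>x \<in> carrier L; y \<in> carrier L\<rbrakk> \<Longrightarrow> h (x \<oplus>\<^bsub>L\<^esub> y) = h x \<oplus>\<^bsub>M\<^esub> h y"
    and "\<lbrakk>c \<in> carrier K; x \<in> carrier L\<rbrakk> \<Longrightarrow> h (c \<odot>\<^bsub>L\<^esub> x) = c \<odot>\<^bsub>M\<^esub> h x"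
    and "\<lbrakk>x \<in> carrier L; y \<in> carrier L\<rbrakk> \<Longrightarrow> h (x \<otimes>\<^bsub>L\<^esub> y) = h x \<otimes>\<^bsub>M\<^esub> h y"
  using assms by (auto simp: algebra_hom_def)

lemma algebra_hom_compose:
  "\<lbrakk>g \<in> algebra_hom K L M; h \<in> algebra_hom K M N\<rbrakk> \<Longrightarrow> h \<circ> g \<in> algebra_hom K L N"
  by (auto simp: algebra_hom_def Pi_iff)

lemma algebra_hom_id: "(\<lambda>x. x) \<in> algebra_hom K L L"
  by (simp add: algebra_hom_def)

context leibniz_algebra
begin

lemma magma_val_closed: "h \<in> X \<rightarrow> carrier L \<Longrightarrow> set_magma t \<subseteq> X \<Longrightarrow> magma_val L h t \<in> carrier L"
  by (induction t) auto

lemma magma_ev_eq: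
  assumes h: "h \<in> X \<rightarrow> carrier L" and p: "p \<in> carrier (magma_algebra K X)"
    and T: "finite T" "{t. p t \<noteq> \<zero>} \<subseteq> T" "\<And>t. t \<in> T \<Longrightarrow> set_magma t \<subseteq> X"
  shows "magma_ev K L h p = (\<Oplus>\<^bsub>L\<^esub>t\<in>T. p t \<odot>\<^bsub>L\<^esub> magma_val L h t)"
  unfolding magma_ev_def
  by (rule M.add.finprod_mono_neutral_cong_left)
     (use p T magma_val_closed[OF h] in \<open>auto simp: magma_algebra_def\<close>)

lemma magma_ev_elem:
  assumes h: "h \<in> X \<rightarrow> carrier L" and t: "set_magma t \<subseteq> X"
  shows "magma_ev K L h (magma_elem K t) = magma_val L h t"
proof -
  have "magma_ev K L h (magma_elem K t) = (\<Oplus>\<^bsub>L\<^esub>s\<in>{t}. magma_elem K t s \<odot>\<^bsub>L\<^esub> magma_val L h s)"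
    using t by (intro magma_ev_eq[OF h magma_elem_closed[OF field_axioms t]]) (auto simp: magma_elem_def)
  then show ?thesis using magma_val_closed[OF h t] by (simp add: magma_elem_def)
qed

lemma magma_ev_hom:
  assumes h: "h \<in> X \<rightarrow> carrier L"
  shows "magma_ev K L h \<in> algebra_hom K (magma_algebra K X) L"
proof -
  let ?A = "magma_algebra K X" and ?e = "magma_ev K L h"
  interpret A: nonassoc_algebra K ?A by (rule magma_algebra_nonassoc) (rule R.is_cring)
  note v = magma_val_closed[OF h] and el = magma_elem_closed[OF field_axioms]
  have supp: "finite {t. p t \<noteq> \<zero>}" "\<And>t. p t \<noteq> \<zero> \<Longrightarrow> set_magma t \<subseteq> X" "\<And>t. p t \<in> carrier K"
    if "p \<in> carrier ?A" for p using that by (auto simp: magma_algebra_def)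
  have cl: "?e p \<in> carrier L" if "p \<in> carrier ?A" for p
    unfolding magma_ev_def using supp[OF that] v by (intro M.finsum_closed) auto
  have add: "?e (p \<oplus>\<^bsub>?A\<^esub> q) = ?e p \<oplus>\<^bsub>L\<^esub> ?e q" if p: "p \<in> carrier ?A" and q: "q \<in> carrier ?A" for p q
  proof -
    let ?T = "{t. p t \<noteq> \<zero>} \<union> {t. q t \<noteq> \<zero>}"
    note s = supp[OF p] supp[OF q]
    have fin: "finite ?T" and tr: "t \<in> ?T \<Longrightarrow> set_magma t \<subseteq> X" for t using s by auto
    have "?e (p \<oplus>\<^bsub>?A\<^esub> q) = (\<Oplus>\<^bsub>L\<^esub>t\<in>?T. (p t \<oplus> q t) \<odot>\<^bsub>L\<^esub> magma_val L h t)"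
      using A.M.a_closed[OF p q] fin tr s
      by (subst magma_ev_eq[OF h _ fin]) (auto simp: magma_algebra_simps)
    also have "\<dots> = (\<Oplus>\<^bsub>L\<^esub>t\<in>?T. p t \<odot>\<^bsub>L\<^esub> magma_val L h t \<oplus>\<^bsub>L\<^esub> q t \<odot>\<^bsub>L\<^esub> magma_val L h t)"
      using s v tr by (intro M.finsum_cong') (auto simp: smult_l_distr)
    also have "\<dots> = (\<Oplus>\<^bsub>L\<^esub>t\<in>?T. p t \<odot>\<^bsub>L\<^esub> magma_val L h t) \<oplus>\<^bsub>L\<^esub> (\<Oplus>\<^bsub>L\<^esub>t\<in>?T. q t \<odot>\<^bsub>L\<^esub> magma_val L h t)"
      using s v tr by (intro M.finsum_addf) auto
    also have "(\<Oplus>\<^bsub>L\<^esub>t\<in>?T. p t \<odot>\<^bsub>L\<^esub> magma_val L h t) = ?e p"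
      by (rule magma_ev_eq[OF h p fin _ tr, symmetric]) auto
    also have "(\<Oplus>\<^bsub>L\<^esub>t\<in>?T. q t \<odot>\<^bsub>L\<^esub> magma_val L h t) = ?e q"
      by (rule magma_ev_eq[OF h q fin _ tr, symmetric]) auto
    finally show ?thesis .
  qed
  have smult: "?e (c \<odot>\<^bsub>?A\<^esub> p) = c \<odot>\<^bsub>L\<^esub> ?e p" if c: "c \<in> carrier K" and p: "p \<in> carrier ?A" for c p
  proof -
    let ?T = "{t. p t \<noteq> \<zero>}"
    note s = supp[OF p]
    have "?e (c \<odot>\<^bsub>?A\<^esub> p) = (\<Oplus>\<^bsub>L\<^esub>t\<in>?T. (c \<otimes> p t) \<odot>\<^bsub>L\<^esub> magma_val L h t)"
      using A.smult_closed[OF c p] s c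
      by (subst magma_ev_eq[OF h _ s(1)]) (auto simp: magma_algebra_simps)
    also have "\<dots> = (\<Oplus>\<^bsub>L\<^esub>t\<in>?T. c \<odot>\<^bsub>L\<^esub> (p t \<odot>\<^bsub>L\<^esub> magma_val L h t))"
      using s v c by (intro M.finsum_cong') (auto simp: smult_assoc1)
    also have "\<dots> = c \<odot>\<^bsub>L\<^esub> ?e p"
      unfolding magma_ev_def using s v c by (intro finsum_smult_ldistr[symmetric]) auto
    finally show ?thesis .
  qed
  have zero: "?e \<zero>\<^bsub>?A\<^esub> = \<zero>\<^bsub>L\<^esub>" by (simp add: magma_ev_def magma_algebra_simps)
  have mult1: "?e (magma_elem K s \<otimes>\<^bsub>?A\<^esub> q) = magma_val L h s \<otimes>\<^bsub>L\<^esub> ?e q"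
    if s: "set_magma s \<subseteq> X" and q: "q \<in> carrier ?A" for s q
  proof (rule magma_algebra_induct[OF field_axioms q], goal_cases)
    case 1
    then show ?case using el[OF s] v[OF s] by (simp add: zero)
  next
    case (2 c t p)
    then show ?case
      using el[OF s] v[OF s] el[of t X] v[of t] cl[of p] s el[of "Prod s t" X]
      by (simp add: A.bracket_add_right A.bracket_smult_right add smult magma_elem_Prod[OF field_axioms]
          magma_ev_elem[OF h] bracket_add_right bracket_smult_right)
  qed
  have mult: "?e (p \<otimes>\<^bsub>?A\<^esub> q) = ?e p \<otimes>\<^bsub>L\<^esub> ?e q" if p: "p \<in> carrier ?A" and q: "q \<in> carrier ?A" for p q
  proof (rule magma_algebra_induct[OF field_axioms p], goal_cases)
    case 1
    then show ?case using q cl[OF q] by (simp add: zero)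
  next
    case (2 c t p)
    then show ?case
      using el[of t X] v[of t] cl[of p] q cl[OF q]
      by (simp add: A.bracket_add_left A.bracket_smult_left add smult mult1
          magma_ev_elem[OF h] bracket_add_left bracket_smult_left)
  qed
  show ?thesis using cl add smult mult by (auto simp: algebra_hom_def)
qed

lemma magma_ev_kernel:
  assumes h: "h \<in> X \<rightarrow> carrier L" and i: "i \<in> leibniz_ideal K (magma_algebra K X)"
  shows "magma_ev K L h i = \<zero>\<^bsub>L\<^esub>"
proof -
  let ?A = "magma_algebra K X" and ?e = "magma_ev K L h"
  interpret A: nonassoc_algebra K ?A by (rule magma_algebra_nonassoc) (rule R.is_cring)
  note e = algebra_homD[OF magma_ev_hom[OF h]]
  have zero: "?e \<zero>\<^bsub>?A\<^esub> = \<zero>\<^bsub>L\<^esub>" by (simp add: magma_ev_def magma_algebra_simps)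
  have minus: "?e (\<ominus>\<^bsub>?A\<^esub> p) = \<ominus>\<^bsub>L\<^esub> ?e p" if p: "p \<in> carrier ?A" for p
    using e(2)[of "\<ominus>\<^bsub>?A\<^esub> p" p] e(1) p
    by (intro M.minus_equality[symmetric]) (auto simp: A.M.l_neg zero)
  let ?N = "{p \<in> carrier ?A. ?e p = \<zero>\<^bsub>L\<^esub>}"
  have "two_sided_ideal ?N K ?A"
    unfolding two_sided_ideal_def
    by (intro conjI A.submoduleI) (auto simp: e zero minus)
  moreover have "x \<otimes>\<^bsub>?A\<^esub> (y \<otimes>\<^bsub>?A\<^esub> z) \<ominus>\<^bsub>?A\<^esub> ((x \<otimes>\<^bsub>?A\<^esub> y) \<otimes>\<^bsub>?A\<^esub> z \<ominus>\<^bsub>?A\<^esub> (x \<otimes>\<^bsub>?A\<^esub> z) \<otimes>\<^bsub>?A\<^esub> y) \<in> ?N"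
    if "x \<in> carrier ?A" "y \<in> carrier ?A" "z \<in> carrier ?A" for x y z
    using that e(1) leibniz[of "?e x" "?e y" "?e z"]
    by (simp add: a_minus_def e minus M.r_neg)
  ultimately have "leibniz_ideal K ?A \<subseteq> ?N" unfolding leibniz_ideal_def by blast
  then show ?thesis using i by auto
qed

lemma free_leibniz_hom_exists:
  assumes h: "h \<in> X \<rightarrow> carrier L"
  shows "\<exists>\<phi>\<in>algebra_hom K (free_leibniz K X) L. \<forall>x\<in>X. \<phi> (free_gen K X x) = h x"
proof -
  let ?A = "magma_algebra K X" and ?e = "magma_ev K L h"
  interpret A: nonassoc_algebra K ?A by (rule magma_algebra_nonassoc) (rule R.is_cring)
  let ?I = "leibniz_ideal K ?A"
  note q = A.quot_algebra_simps[OF A.leibniz_ideal(1), folded free_leibniz_def]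
  note e = algebra_homD[OF magma_ev_hom[OF h]]
  interpret I: abelian_subgroup ?I ?A
    using A.leibniz_ideal(1) unfolding two_sided_ideal_def by (intro A.submodule_abelian_subgroup) (rule conjunct1)
  have img: "the_elem (?e ` (?I +>\<^bsub>?A\<^esub> p)) = ?e p" if p: "p \<in> carrier ?A" for p
  proof -
    have "?e x = ?e p" if x: "x \<in> ?I +>\<^bsub>?A\<^esub> p" for x
    proof -
      obtain i where i: "i \<in> ?I" "x = i \<oplus>\<^bsub>?A\<^esub> p" using x unfolding a_r_coset_def' by blast
      have "?e x = ?e i \<oplus>\<^bsub>L\<^esub> ?e p" using e(2)[of i p] i p I.a_subset by blast
      then show ?thesis using magma_ev_kernel[OF h i(1)] e(1)[OF p] by simp
    qed
    then have "?e ` (?I +>\<^bsub>?A\<^esub> p) = {?e p}" using I.a_rcos_self[OF p] by blast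
    then show ?thesis by simp
  qed
  have "(\<lambda>A. the_elem (?e ` A)) \<in> algebra_hom K (free_leibniz K X) L"
    unfolding algebra_hom_def
  proof (intro CollectI conjI ballI Pi_I, goal_cases)
    case (1 U)
    then obtain p where "p \<in> carrier ?A" "U = ?I +>\<^bsub>?A\<^esub> p" unfolding q(1) by blast
    then show ?case using e(1) by (simp only: img)
  next
    case (2 U V)
    then obtain p r where pr: "p \<in> carrier ?A" "U = ?I +>\<^bsub>?A\<^esub> p" "r \<in> carrier ?A" "V = ?I +>\<^bsub>?A\<^esub> r"
      unfolding q(1) by blast
    show ?case using pr A.M.a_closed[OF pr(1,3)] by (simp only: q(3) img e(2))
  next
    case (3 c U)
    then obtain p where p: "p \<in> carrier ?A" "U = ?I +>\<^bsub>?A\<^esub> p" unfolding q(1) by blast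
    show ?case using p 3(1) A.smult_closed[OF 3(1) p(1)] by (simp only: q(5) img e(3))
  next
    case (4 U V)
    then obtain p r where pr: "p \<in> carrier ?A" "U = ?I +>\<^bsub>?A\<^esub> p" "r \<in> carrier ?A" "V = ?I +>\<^bsub>?A\<^esub> r"
      unfolding q(1) by blast
    show ?case using pr A.bracket_closed[OF pr(1,3)] by (simp only: q(4) img e(4))
  qed
  moreover have "the_elem (?e ` free_gen K X x) = h x" if "x \<in> X" for x
    using that by (simp add: free_gen_def img magma_elem_closed[OF field_axioms] magma_ev_elem[OF h])
  ultimately show ?thesis by (intro bexI[of _ "\<lambda>A. the_elem (?e ` A)"] ballI)
qed

end

lemma free_gen_closed:
  assumes "field K" "x \<in> X" shows "free_gen K X x \<in> carrier (free_leibniz K X)"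
proof -
  interpret field K by fact
  interpret A: nonassoc_algebra K "magma_algebra K X" by (rule magma_algebra_nonassoc) (rule is_cring)
  show ?thesis
    using assms(2) magma_elem_closed[OF assms(1), of "Gen x" X]
    by (simp add: free_leibniz_def free_gen_def A.quot_algebra_simps A.leibniz_ideal)
qed

lemma free_leibniz_hom_unique:
  assumes K: "field K" and L: "leibniz_algebra K L"
    and \<phi>: "\<phi> \<in> algebra_hom K (free_leibniz K X) L" and \<psi>: "\<psi> \<in> algebra_hom K (free_leibniz K X) L"
    and eq: "\<And>x. x \<in> X \<Longrightarrow> \<phi> (free_gen K X x) = \<psi> (free_gen K X x)"
    and x: "x \<in> carrier (free_leibniz K X)"
  shows "\<phi> x = \<psi> x"
proof -
  interpret L: leibniz_algebra K L by fact
  let ?A = "magma_algebra K X" and ?I = "leibniz_ideal K (magma_algebra K X)"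
  interpret A: nonassoc_algebra K ?A by (rule magma_algebra_nonassoc) (rule L.R.is_cring)
  note q = A.quot_algebra_simps[OF A.leibniz_ideal(1), folded free_leibniz_def]
  interpret F: leibniz_algebra K "free_leibniz K X" by (rule free_leibniz_algebra[OF K])
  note a = algebra_homD[OF \<phi>] and b = algebra_homD[OF \<psi>] and el = magma_elem_closed[OF K]
  have cl: "?I +>\<^bsub>?A\<^esub> p \<in> carrier (free_leibniz K X)" if "p \<in> carrier ?A" for p
    using that by (simp add: q)
  have gen: "set_magma t \<subseteq> X \<Longrightarrow> \<phi> (?I +>\<^bsub>?A\<^esub> magma_elem K t) = \<psi> (?I +>\<^bsub>?A\<^esub> magma_elem K t)" for t
  proof (induction t)
    case (Gen x)
    then show ?case using eq by (simp add: free_gen_def)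
  next
    case (Prod s t)
    have "?I +>\<^bsub>?A\<^esub> magma_elem K (Prod s t) =
        (?I +>\<^bsub>?A\<^esub> magma_elem K s) \<otimes>\<^bsub>free_leibniz K X\<^esub> (?I +>\<^bsub>?A\<^esub> magma_elem K t)"
      using Prod.prems el[of s X] el[of t X] by (simp add: q magma_elem_Prod[OF K])
    then show ?case using Prod el[of s X] el[of t X] by (simp add: a b cl)
  qed
  obtain p where p: "p \<in> carrier ?A" "x = ?I +>\<^bsub>?A\<^esub> p" using x by (auto simp: q)
  have "\<phi> (?I +>\<^bsub>?A\<^esub> p) = \<psi> (?I +>\<^bsub>?A\<^esub> p)"
  proof (rule magma_algebra_induct[OF K p(1)], goal_cases)
    case 1
    have z: "\<chi> \<zero>\<^bsub>free_leibniz K X\<^esub> = \<zero>\<^bsub>L\<^esub>" if "\<chi> \<in> algebra_hom K (free_leibniz K X) L" for \<chi>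
      using algebra_homD(1)[OF that, of "\<zero>\<^bsub>free_leibniz K X\<^esub>"] algebra_homD(3)[OF that, of "\<zero>\<^bsub>K\<^esub>" "\<zero>\<^bsub>free_leibniz K X\<^esub>"]
      by simp
    show ?case unfolding q(2)[symmetric] z[OF \<phi>] z[OF \<psi>] by (rule refl)
  next
    case (2 c t p)
    have "?I +>\<^bsub>?A\<^esub> (c \<odot>\<^bsub>?A\<^esub> magma_elem K t \<oplus>\<^bsub>?A\<^esub> p) =
        c \<odot>\<^bsub>free_leibniz K X\<^esub> (?I +>\<^bsub>?A\<^esub> magma_elem K t) \<oplus>\<^bsub>free_leibniz K X\<^esub> (?I +>\<^bsub>?A\<^esub> p)"
      using 2 el[of t X] by (simp add: q)
    then show ?case using 2 el[of t X] by (simp add: a b cl gen)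
  qed
  then show ?thesis using p by simp
qed

lemma algebra_iso_inverse:
  assumes L: "nonassoc_algebra K L" and h: "h \<in> algebra_iso K L M"
  shows "inv_into (carrier L) h \<in> algebra_hom K M L"
proof -
  interpret nonassoc_algebra K L by fact
  note hom = algebra_homD[of h K L M]
  have H: "h \<in> algebra_hom K L M" and b: "bij_betw h (carrier L) (carrier M)"
    using h by (auto simp: algebra_iso_def)
  let ?g = "inv_into (carrier L) h"
  have g: "?g y \<in> carrier L" "h (?g y) = y" if "y \<in> carrier M" for y
    using b that by (auto simp: bij_betw_def inv_into_into f_inv_into_f)
  have inj: "?g y = x" if "x \<in> carrier L" "h x = y" for x y
    using b that by (auto simp: bij_betw_def)
  show ?thesis
    unfolding algebra_hom_def using g by (auto intro!: inj simp: hom[OF H])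
qed

theorem free_on_universal:
  assumes F: "free_on K F B" and L: "leibniz_algebra K L" and h: "h \<in> B \<rightarrow> carrier L"
  shows "\<exists>\<phi>\<in>algebra_hom K F L. (\<forall>b\<in>B. \<phi> b = h b) \<and>
    (\<forall>\<psi>\<in>algebra_hom K F L. (\<forall>b\<in>B. \<psi> b = h b) \<longrightarrow> (\<forall>x\<in>carrier F. \<psi> x = \<phi> x))"
proof -
  interpret L: leibniz_algebra K L by fact
  have K: "field K" by (rule L.field_axioms)
  let ?F = "free_leibniz K B"
  interpret F: leibniz_algebra K ?F by (rule free_leibniz_algebra[OF K])
  obtain i where i: "i \<in> algebra_iso K ?F F" "\<And>b. b \<in> B \<Longrightarrow> i (free_gen K B b) = b"
    using F by (auto simp: free_on_def)
  let ?j = "inv_into (carrier ?F) i"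
  have ih: "i \<in> algebra_hom K ?F F" and ib: "bij_betw i (carrier ?F) (carrier F)"
    using i by (auto simp: algebra_iso_def)
  have j: "?j \<in> algebra_hom K F ?F"
    by (rule algebra_iso_inverse[OF F.nonassoc_algebra_axioms i(1)])
  have jb: "?j b = free_gen K B b" if "b \<in> B" for b
    using ib i(2)[OF that] free_gen_closed[OF K that] by (metis bij_betw_def inv_into_f_f)
  obtain g where g: "g \<in> algebra_hom K ?F L" "\<And>b. b \<in> B \<Longrightarrow> g (free_gen K B b) = h b"
    using L.free_leibniz_hom_exists[OF h] by blast
  have "\<psi> x = (g \<circ> ?j) x"
    if \<psi>: "\<psi> \<in> algebra_hom K F L" "\<forall>b\<in>B. \<psi> b = h b" and x: "x \<in> carrier F" for \<psi> x
  proof -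
    have "(\<psi> \<circ> i) (?j x) = g (?j x)"
      by (rule free_leibniz_hom_unique[OF K L algebra_hom_compose[OF ih \<psi>(1)] g(1)])
         (use \<psi>(2) i(2) g(2) algebra_homD(1)[OF j x] in auto)
    then show ?thesis using ib x by (simp add: bij_betw_def f_inv_into_f)
  qed
  then show ?thesis
    using algebra_hom_compose[OF j g(1)] jb g(2) by (intro bexI[of _ "g \<circ> ?j"]) auto
qed

lemma free_leibniz_free_on:
  assumes K: "field K" shows "free_on K (free_leibniz K X) (free_gen K X ` X)"
proof -
  let ?B = "free_gen K X ` X"
  let ?F = "free_leibniz K X" and ?G = "free_leibniz K ?B"
  interpret F: leibniz_algebra K ?F by (rule free_leibniz_algebra[OF K])
  interpret G: leibniz_algebra K ?G by (rule free_leibniz_algebra[OF K])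
  have "(\<lambda>b. b) \<in> ?B \<rightarrow> carrier ?F" using free_gen_closed[OF K] by auto
  from F.free_leibniz_hom_exists[OF this]
  obtain i where i: "i \<in> algebra_hom K ?G ?F" "\<forall>b\<in>?B. i (free_gen K ?B b) = b"
    by (rule bexE)
  have "(\<lambda>x. free_gen K ?B (free_gen K X x)) \<in> X \<rightarrow> carrier ?G"
    by (intro Pi_I free_gen_closed[OF K] imageI)
  from G.free_leibniz_hom_exists[OF this]
  obtain j where j: "j \<in> algebra_hom K ?F ?G"
      "\<forall>x\<in>X. j (free_gen K X x) = free_gen K ?B (free_gen K X x)"
    by (rule bexE)
  note id = algebra_hom_id
  have ij: "(i \<circ> j) x = x" if "x \<in> carrier ?F" for x
    by (rule free_leibniz_hom_unique[OF K F.leibniz_algebra_axioms algebra_hom_compose[OF j(1) i(1)] id _ that])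
       (simp add: i(2) j(2))
  have ji: "(j \<circ> i) x = x" if "x \<in> carrier ?G" for x
    by (rule free_leibniz_hom_unique[OF K G.leibniz_algebra_axioms algebra_hom_compose[OF i(1) j(1)] id _ that])
       (auto simp: i(2) j(2))
  have "bij_betw i (carrier ?G) (carrier ?F)"
  proof (rule bij_betw_byWitness[of _ j])
    show "i ` carrier ?G \<subseteq> carrier ?F" "j ` carrier ?F \<subseteq> carrier ?G"
      by (intro image_subsetI algebra_homD(1)[OF i(1)], assumption)
         (intro image_subsetI algebra_homD(1)[OF j(1)], assumption)
  qed (simp_all add: ij[unfolded o_def] ji[unfolded o_def])
  then have "i \<in> algebra_iso K ?G ?F" using i(1) by (simp add: algebra_iso_def)
  moreover have "?B \<subseteq> carrier ?F" by (intro image_subsetI free_gen_closed[OF K])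
  ultimately show ?thesis
    unfolding free_on_def using i(2) F.leibniz_algebra_axioms by (intro conjI bexI[of _ i])
qed

theorem free_presentation_exists:
  assumes G: "leibniz_algebra K G"
  shows "\<exists>\<rho>. free_presentation K (free_leibniz K (carrier G)) G \<rho>"
proof -
  interpret G: leibniz_algebra K G by fact
  note K = G.field_axioms
  obtain \<rho> where r: "\<rho> \<in> algebra_hom K (free_leibniz K (carrier G)) G"
      "\<And>x. x \<in> carrier G \<Longrightarrow> \<rho> (free_gen K (carrier G) x) = x"
    using G.free_leibniz_hom_exists[of "\<lambda>x. x" "carrier G"] by blast
  have "\<rho> ` carrier (free_leibniz K (carrier G)) = carrier G"
  proof
    show "carrier G \<subseteq> \<rho> ` carrier (free_leibniz K (carrier G))"
      using r(2) free_gen_closed[OF K] by (metis image_eqI subsetI)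
  qed (use algebra_homD(1)[OF r(1)] in auto)
  then show ?thesis
    using r(1) G free_leibniz_algebra[OF K] free_leibniz_free_on[OF K]
    unfolding free_presentation_def leibniz_extension_def by blast
qed

end

theory Submission
  imports Defs
begin

text \<open>
  Write \<open>\<nn> = ker f\<close>, \<open>\<rr> = ker \<rho>\<close>, \<open>\<ss> = ker (f \<circ> \<rho>)\<close>, \<open>D = [F, F]\<close> and \<open>J = [\<ss>, F]\<close>, both brackets taken
  relative to Lie. The map \<open>\<theta>\<^sup>*\<close> sends the class of \<open>x \<in> \<ss> \<inter> D\<close> modulo \<open>J\<close> to \<open>\<rho> x\<close>. It is well defined
  because \<open>\<rho>\<close> maps \<open>J\<close> onto the bracket of \<open>\<nn>\<close> with \<open>G\<close>, which vanishes for a Lie-central extension,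
  and it is always a homomorphism. So \<open>\<theta>\<^sup>*\<close> is an isomorphism iff it is injective and surjective, and
  these two properties match the two defining properties of a stem cover separately.

  The kernel of \<open>\<theta>\<^sup>*\<close> is \<open>(\<rr> \<inter> D) / J\<close>. This is also the image of the map from the homology of \<open>G\<close> to
  that of \<open>Q\<close>, which is induced by \<open>\<rr> \<subseteq> \<ss>\<close> (\<open>HL2_Lie_map_zero_iff\<close>). Hence \<open>\<theta>\<^sup>*\<close> is injective iff that
  map is zero; this is exactness of \<open>HL\<^sub>2(G) \<rightarrow> HL\<^sub>2(Q) \<rightarrow> \<nn>\<close>.

  The image of \<open>\<theta>\<^sup>*\<close> is \<open>\<rho> (\<ss> \<inter> D) = \<nn> \<inter> \<rho> D\<close>. Since \<open>2\<close> is invertible, the symmetrised brackets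
  span the same subspace as the squares (\<open>lie_comm_eq_leibniz_ann\<close>), so \<open>\<rho> D\<close> is the annihilator ideal
  \<open>ann G\<close> spanned by the squares. Hence \<open>\<theta>\<^sup>*\<close> is surjective iff \<open>\<nn> \<subseteq> ann G\<close>. As \<open>f\<close> maps \<open>ann G\<close> onto
  \<open>ann Q\<close>, the kernel of the map of Lie quotients is \<open>(\<nn> + ann G) / ann G\<close>, so the same inclusion says
  that this map is an isomorphism (\<open>liezation_iso_iff\<close>).
\<close>

section \<open>Linear spans and homomorphisms\<close>

context module
begin

lemma submodule_if_closed:
  assumes "H \<subseteq> carrier M" "\<zero>\<^bsub>M\<^esub> \<in> H"
    and "\<And>x y. \<lbrakk>x \<in> H; y \<in> H\<rbrakk> \<Longrightarrow> x \<oplus>\<^bsub>M\<^esub> y \<in> H"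
    and smult: "\<And>c x. \<lbrakk>c \<in> carrier R; x \<in> H\<rbrakk> \<Longrightarrow> c \<odot>\<^bsub>M\<^esub> x \<in> H"
  shows "submodule H R M"
proof (rule submoduleI[OF assms(1,2) _ assms(3,4)])
  fix x assume "x \<in> H"
  then show "\<ominus>\<^bsub>M\<^esub> x \<in> H"
    using smult[of "\<ominus>\<^bsub>R\<^esub> \<one>\<^bsub>R\<^esub>" x] assms(1) by (auto simp: smult_l_minus subset_iff)
qed

lemma submodule_zero: "submodule H R M \<Longrightarrow> \<zero>\<^bsub>M\<^esub> \<in> H"
  using subgroup.one_closed[OF submodule.axioms(1)] by fastforce

lemma lin_span_submodule:
  assumes "S \<subseteq> carrier M"
  shows "submodule (lin_span R M S) R M"
proof (rule submodule_if_closed)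
  show "lin_span R M S \<subseteq> carrier M"
    unfolding lin_span_def using assms carrier_is_submodule by blast
  show "\<zero>\<^bsub>M\<^esub> \<in> lin_span R M S"
    by (auto simp: lin_span_def submodule_zero)
qed (auto simp: lin_span_def submoduleE)

lemma lin_span_superset: "S \<subseteq> lin_span R M S"
  by (auto simp: lin_span_def)

lemma lin_span_minimal: "\<lbrakk>submodule H R M; S \<subseteq> H\<rbrakk> \<Longrightarrow> lin_span R M S \<subseteq> H"
  by (auto simp: lin_span_def)

lemma submodule_minus: "\<lbrakk>submodule H R M; x \<in> H; y \<in> H\<rbrakk> \<Longrightarrow> x \<ominus>\<^bsub>M\<^esub> y \<in> H"
  by (simp add: a_minus_def submoduleE)

lemma diff_zero: "x \<in> carrier M \<Longrightarrow> x \<ominus>\<^bsub>M\<^esub> \<zero>\<^bsub>M\<^esub> = x"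
  using M.minus_equality[of "\<zero>\<^bsub>M\<^esub>" "\<zero>\<^bsub>M\<^esub>"] by (simp add: a_minus_def)

lemma rcoset_eq_iff:
  assumes "submodule H R M" "x \<in> carrier M" "y \<in> carrier M"
  shows "H +>\<^bsub>M\<^esub> x = H +>\<^bsub>M\<^esub> y \<longleftrightarrow> x \<ominus>\<^bsub>M\<^esub> y \<in> H"
proof -
  interpret H: abelian_subgroup H M by (rule submodule_abelian_subgroup[OF assms(1)])
  show ?thesis
    using assms H.a_rcos_module[of y x] H.a_repr_independence'[of x y] H.a_rcos_self[of x]
    by (auto simp: a_minus_def)
qed

end

lemma lin_span_mono: "S \<subseteq> T \<Longrightarrow> lin_span K L S \<subseteq> lin_span K L T"
  by (auto simp: lin_span_def)

lemma algebra_hom_zero_diff: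
  assumes "module K L" "module K M" and h: "h \<in> algebra_hom K L M"
  shows "h \<zero>\<^bsub>L\<^esub> = \<zero>\<^bsub>M\<^esub>"
    and "\<lbrakk>x \<in> carrier L; y \<in> carrier L\<rbrakk> \<Longrightarrow> h (x \<ominus>\<^bsub>L\<^esub> y) = h x \<ominus>\<^bsub>M\<^esub> h y"
proof -
  interpret L: module K L by fact
  interpret M: module K M by fact
  note hD = algebra_homD[OF h]
  show z: "h \<zero>\<^bsub>L\<^esub> = \<zero>\<^bsub>M\<^esub>"
    using hD(1)[of "\<zero>\<^bsub>L\<^esub>"] hD(3)[of "\<zero>\<^bsub>K\<^esub>" "\<zero>\<^bsub>L\<^esub>"] by simp
  have m: "h (\<ominus>\<^bsub>L\<^esub> x) = \<ominus>\<^bsub>M\<^esub> h x" if "x \<in> carrier L" for x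
    using that hD(1) hD(2)[of "\<ominus>\<^bsub>L\<^esub> x" x]
    by (intro M.M.minus_equality[symmetric]) (auto simp: L.M.l_neg z)
  show "\<lbrakk>x \<in> carrier L; y \<in> carrier L\<rbrakk> \<Longrightarrow> h (x \<ominus>\<^bsub>L\<^esub> y) = h x \<ominus>\<^bsub>M\<^esub> h y"
    by (simp add: a_minus_def m hD)
qed

lemma algebra_hom_preimage_submodule:
  assumes "module K L" "module K M" and h: "h \<in> algebra_hom K L M" and H: "submodule H K M"
  shows "submodule {x \<in> carrier L. h x \<in> H} K L"
proof -
  interpret L: module K L by fact
  interpret M: module K M by fact
  show ?thesis
    by (rule L.submodule_if_closed)
       (auto simp: algebra_homD[OF h] algebra_hom_zero_diff[OF assms(1-3)] M.submoduleE[OF H]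
          M.submodule_zero[OF H])
qed

lemma algebra_hom_image_submodule:
  assumes "module K L" "module K M" and h: "h \<in> algebra_hom K L M" and H: "submodule H K L"
  shows "submodule (h ` H) K M"
proof -
  interpret L: module K L by fact
  interpret M: module K M by fact
  note E = L.submoduleE[OF H] and hD = algebra_homD[OF h]
  have c: "x \<in> H \<Longrightarrow> x \<in> carrier L" for x using E(1) by blast
  note im = imageI[of _ H h]
  show ?thesis
  proof (rule M.submodule_if_closed, goal_cases)
    case 2 show ?case
      using im[OF L.submodule_zero[OF H]] by (simp add: algebra_hom_zero_diff[OF assms(1-3)])
  next
    case (3 a b) then show ?case using im[OF E(5)] c hD(2)[symmetric] by auto
  next
    case (4 k a) then show ?case using im[OF E(4)] c hD(3)[symmetric] by auto
  qed (use c hD(1) in auto)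
qed

text \<open>Homomorphisms commute with spans because submodules pull back and push forward along them.\<close>

lemma algebra_hom_lin_span:
  assumes "module K L" "module K M" and h: "h \<in> algebra_hom K L M" and S: "S \<subseteq> carrier L"
  shows "h ` lin_span K L S = lin_span K M (h ` S)"
proof
  interpret L: module K L by fact
  interpret M: module K M by fact
  have hS: "h ` S \<subseteq> carrier M" using S algebra_homD(1)[OF h] by auto
  have "lin_span K L S \<subseteq> {x \<in> carrier L. h x \<in> lin_span K M (h ` S)}"
    using S M.lin_span_superset[of "h ` S"]
    by (intro L.lin_span_minimal algebra_hom_preimage_submodule[OF assms(1-3)]
        M.lin_span_submodule hS) auto
  then show "h ` lin_span K L S \<subseteq> lin_span K M (h ` S)" by blast
  show "lin_span K M (h ` S) \<subseteq> h ` lin_span K L S"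
    by (intro M.lin_span_minimal algebra_hom_image_submodule[OF assms(1-3)]
        L.lin_span_submodule S image_mono L.lin_span_superset)
qed

section \<open>Squares and symmetrised brackets\<close>

lemma (in nonassoc_algebra) lie_comm_submodule:
  assumes "A \<subseteq> carrier L" "B \<subseteq> carrier L"
  shows "submodule (lie_comm K L A B) K L"
  unfolding lie_comm_def using assms by (intro lin_span_submodule) auto

lemma algebra_hom_lie_comm:
  assumes L: "nonassoc_algebra K L" and M: "nonassoc_algebra K M" and h: "h \<in> algebra_hom K L M"
    and AB: "A \<subseteq> carrier L" "B \<subseteq> carrier L"
  shows "h ` lie_comm K L A B = lie_comm K M (h ` A) (h ` B)"
proof -
  interpret L: nonassoc_algebra K L by fact
  interpret M: nonassoc_algebra K M by fact
  have eq: "h (a \<otimes>\<^bsub>L\<^esub> b \<oplus>\<^bsub>L\<^esub> b \<otimes>\<^bsub>L\<^esub> a) = h a \<otimes>\<^bsub>M\<^esub> h b \<oplus>\<^bsub>M\<^esub> h b \<otimes>\<^bsub>M\<^esub> h a" if "a \<in> A" "b \<in> B" for a b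
    using that AB by (simp add: subset_iff algebra_homD[OF h])
  have "h ` {a \<otimes>\<^bsub>L\<^esub> b \<oplus>\<^bsub>L\<^esub> b \<otimes>\<^bsub>L\<^esub> a | a b. a \<in> A \<and> b \<in> B} =
      {a \<otimes>\<^bsub>M\<^esub> b \<oplus>\<^bsub>M\<^esub> b \<otimes>\<^bsub>M\<^esub> a | a b. a \<in> h ` A \<and> b \<in> h ` B}"
    (is "h ` ?X = ?Y")
  proof (intro equalityI subsetI)
    fix z assume "z \<in> ?Y"
    then obtain a b where "a \<in> A" "b \<in> B" "z = h a \<otimes>\<^bsub>M\<^esub> h b \<oplus>\<^bsub>M\<^esub> h b \<otimes>\<^bsub>M\<^esub> h a" by blast
    then show "z \<in> h ` ?X" by (intro image_eqI[of _ _ "a \<otimes>\<^bsub>L\<^esub> b \<oplus>\<^bsub>L\<^esub> b \<otimes>\<^bsub>L\<^esub> a"]) (simp add: eq, blast)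
  qed (use eq in blast)
  moreover have "{a \<otimes>\<^bsub>L\<^esub> b \<oplus>\<^bsub>L\<^esub> b \<otimes>\<^bsub>L\<^esub> a | a b. a \<in> A \<and> b \<in> B} \<subseteq> carrier L"
    using AB by auto
  ultimately show ?thesis
    unfolding lie_comm_def using algebra_hom_lin_span[OF L.module_axioms M.module_axioms h] by simp
qed

lemma (in nonassoc_algebra) leibniz_ann_submodule: "submodule (leibniz_ann K L) K L"
  unfolding leibniz_ann_def by (intro lin_span_submodule) auto

lemma (in nonassoc_algebra) square_in_leibniz_ann: "x \<in> carrier L \<Longrightarrow> x \<otimes>\<^bsub>L\<^esub> x \<in> leibniz_ann K L"
  unfolding leibniz_ann_def by (rule subsetD[OF lin_span_superset]) blast

lemma (in nonassoc_algebra) leibniz_ann_minimal: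
  "\<lbrakk>submodule H K L; \<And>x. x \<in> carrier L \<Longrightarrow> x \<otimes>\<^bsub>L\<^esub> x \<in> H\<rbrakk> \<Longrightarrow> leibniz_ann K L \<subseteq> H"
  unfolding leibniz_ann_def by (rule lin_span_minimal) auto

text \<open>
  Polarisation writes \<open>[x, y] + [y, x]\<close> through the squares of \<open>x + y\<close>, \<open>x\<close> and \<open>y\<close>; conversely
  \<open>[x, x] + [x, x]\<close> is a symmetrised bracket, and halving it gives the square.
\<close>

lemma (in nonassoc_algebra) lie_comm_eq_leibniz_ann:
  assumes two: "\<one>\<^bsub>K\<^esub> \<oplus>\<^bsub>K\<^esub> \<one>\<^bsub>K\<^esub> \<in> Units K"
  shows "lie_comm K L (carrier L) (carrier L) = leibniz_ann K L"
proof
  have cancel: "(p \<oplus>\<^bsub>L\<^esub> (t \<oplus>\<^bsub>L\<^esub> q) \<ominus>\<^bsub>L\<^esub> p) \<ominus>\<^bsub>L\<^esub> q = t"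
    if "p \<in> carrier L" "q \<in> carrier L" "t \<in> carrier L" for p q t
    using that M.a_comm[of p "t \<oplus>\<^bsub>L\<^esub> q"] by (simp add: a_minus_def M.a_assoc M.r_neg)
  have "x \<otimes>\<^bsub>L\<^esub> y \<oplus>\<^bsub>L\<^esub> y \<otimes>\<^bsub>L\<^esub> x \<in> leibniz_ann K L" if "x \<in> carrier L" "y \<in> carrier L" for x y
  proof -
    have "((x \<oplus>\<^bsub>L\<^esub> y) \<otimes>\<^bsub>L\<^esub> (x \<oplus>\<^bsub>L\<^esub> y) \<ominus>\<^bsub>L\<^esub> x \<otimes>\<^bsub>L\<^esub> x) \<ominus>\<^bsub>L\<^esub> y \<otimes>\<^bsub>L\<^esub> y \<in> leibniz_ann K L"
      using that by (intro submodule_minus leibniz_ann_submodule square_in_leibniz_ann) auto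
    also have "(x \<oplus>\<^bsub>L\<^esub> y) \<otimes>\<^bsub>L\<^esub> (x \<oplus>\<^bsub>L\<^esub> y) =
        x \<otimes>\<^bsub>L\<^esub> x \<oplus>\<^bsub>L\<^esub> ((x \<otimes>\<^bsub>L\<^esub> y \<oplus>\<^bsub>L\<^esub> y \<otimes>\<^bsub>L\<^esub> x) \<oplus>\<^bsub>L\<^esub> y \<otimes>\<^bsub>L\<^esub> y)"
      using that by (simp add: bracket_add_left bracket_add_right M.a_ac)
    finally show ?thesis using that cancel by simp
  qed
  then show "lie_comm K L (carrier L) (carrier L) \<subseteq> leibniz_ann K L"
    unfolding lie_comm_def by (intro lin_span_minimal leibniz_ann_submodule) auto
  let ?C = "lie_comm K L (carrier L) (carrier L)"
  have C: "submodule ?C K L" by (simp add: lie_comm_submodule)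
  have "x \<otimes>\<^bsub>L\<^esub> x \<in> ?C" if x: "x \<in> carrier L" for x
  proof -
    let ?u = "inv\<^bsub>K\<^esub> (\<one>\<^bsub>K\<^esub> \<oplus>\<^bsub>K\<^esub> \<one>\<^bsub>K\<^esub>)"
    have "x \<otimes>\<^bsub>L\<^esub> x \<oplus>\<^bsub>L\<^esub> x \<otimes>\<^bsub>L\<^esub> x \<in> ?C"
      unfolding lie_comm_def by (rule subsetD[OF lin_span_superset]) (use x in blast)
    then have "?u \<odot>\<^bsub>L\<^esub> (x \<otimes>\<^bsub>L\<^esub> x \<oplus>\<^bsub>L\<^esub> x \<otimes>\<^bsub>L\<^esub> x) \<in> ?C"
      using submoduleE(4)[OF C] two by simp
    also have "x \<otimes>\<^bsub>L\<^esub> x \<oplus>\<^bsub>L\<^esub> x \<otimes>\<^bsub>L\<^esub> x = (\<one>\<^bsub>K\<^esub> \<oplus>\<^bsub>K\<^esub> \<one>\<^bsub>K\<^esub>) \<odot>\<^bsub>L\<^esub> (x \<otimes>\<^bsub>L\<^esub> x)"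
      using x by (simp add: smult_l_distr)
    also have "?u \<odot>\<^bsub>L\<^esub> \<dots> = x \<otimes>\<^bsub>L\<^esub> x"
      using x two by (simp add: smult_assoc1[symmetric])
    finally show ?thesis .
  qed
  then show "leibniz_ann K L \<subseteq> ?C"
    by (intro leibniz_ann_minimal C)
qed

text \<open>
  The Leibniz identity gives \<open>[x, [y, y]] = 0\<close>. Therefore, with \<open>s = [y, y]\<close>, the square of \<open>s + x\<close>
  reduces to \<open>[s, x] + [x, x]\<close>, so that \<open>[s, x]\<close> is a difference of squares.
\<close>

lemma (in leibniz_algebra) leibniz_ann_ideal: "two_sided_ideal (leibniz_ann K L) K L"
proof -
  note A = leibniz_ann_submodule
  have sq: "x \<otimes>\<^bsub>L\<^esub> (y \<otimes>\<^bsub>L\<^esub> y) = \<zero>\<^bsub>L\<^esub>" if "x \<in> carrier L" "y \<in> carrier L" for x y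
    using that by (simp add: leibniz M.r_neg a_minus_def)
  let ?H = "{i \<in> carrier L. \<forall>x\<in>carrier L. x \<otimes>\<^bsub>L\<^esub> i \<in> leibniz_ann K L \<and> i \<otimes>\<^bsub>L\<^esub> x \<in> leibniz_ann K L}"
  have H: "submodule ?H K L"
    by (rule submodule_if_closed)
       (auto simp: bracket_add_left bracket_add_right bracket_smult_left bracket_smult_right
         submoduleE(4,5)[OF A] submodule_zero[OF A])
  have "(y \<otimes>\<^bsub>L\<^esub> y) \<otimes>\<^bsub>L\<^esub> x \<in> leibniz_ann K L" if xy: "x \<in> carrier L" "y \<in> carrier L" for x y
  proof -
    let ?s = "y \<otimes>\<^bsub>L\<^esub> y"
    have "?s \<otimes>\<^bsub>L\<^esub> x = (?s \<oplus>\<^bsub>L\<^esub> x) \<otimes>\<^bsub>L\<^esub> (?s \<oplus>\<^bsub>L\<^esub> x) \<ominus>\<^bsub>L\<^esub> x \<otimes>\<^bsub>L\<^esub> x"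
      using xy by (simp add: bracket_add_left bracket_add_right sq a_minus_def M.a_assoc M.r_neg)
    then show ?thesis using xy by (simp add: submodule_minus A square_in_leibniz_ann)
  qed
  then have "leibniz_ann K L \<subseteq> ?H"
    by (intro leibniz_ann_minimal H) (auto simp: sq submodule_zero[OF A])
  then show ?thesis using A by (auto simp: two_sided_ideal_def)
qed

section \<open>Maps on quotients\<close>

lemma coset_map_rcoset:
  assumes L: "module K L" and M: "module K M" and h: "h \<in> algebra_hom K L M"
    and I: "submodule I K L" and J: "submodule J K M" and IJ: "h ` I \<subseteq> J" and a: "a \<in> carrier L"
  shows "coset_map M J h (I +>\<^bsub>L\<^esub> a) = J +>\<^bsub>M\<^esub> h a"
proof -
  interpret L: module K L by fact
  interpret M: module K M by fact
  interpret I: abelian_subgroup I L by (rule L.submodule_abelian_subgroup[OF I])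
  interpret J: abelian_subgroup J M by (rule M.submodule_abelian_subgroup[OF J])
  have "J +>\<^bsub>M\<^esub> h x = J +>\<^bsub>M\<^esub> h a" if "x \<in> I +>\<^bsub>L\<^esub> a" for x
  proof -
    obtain i where i: "i \<in> I" "x = i \<oplus>\<^bsub>L\<^esub> a" using \<open>x \<in> I +>\<^bsub>L\<^esub> a\<close> by (auto simp: a_r_coset_def')
    then have "h x = h i \<oplus>\<^bsub>M\<^esub> h a" using a I.a_subset by (auto simp: algebra_homD[OF h])
    then show ?thesis using i IJ a by (auto simp: J.coset_add_mem algebra_homD[OF h])
  qed
  then show ?thesis unfolding coset_map_def using I.a_rcos_self[OF a] by blast
qed

lemma coset_map_iso_iff:
  assumes L: "nonassoc_algebra K L" and M: "nonassoc_algebra K M" and h: "h \<in> algebra_hom K L M"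
    and surj: "h ` carrier L = carrier M"
    and I: "two_sided_ideal I K L" and J: "two_sided_ideal J K M" and IJ: "h ` I \<subseteq> J"
  shows "coset_map M J h \<in> algebra_iso K (quot_algebra L I) (quot_algebra M J) \<longleftrightarrow>
    {x \<in> carrier L. h x \<in> J} \<subseteq> I"
proof -
  interpret L: nonassoc_algebra K L by fact
  interpret M: nonassoc_algebra K M by fact
  note hD = algebra_homD[OF h] and qL = L.quot_algebra_simps[OF I] and qM = M.quot_algebra_simps[OF J]
  have sI: "submodule I K L" and sJ: "submodule J K M" using I J by (auto simp: two_sided_ideal_def)
  have cm: "coset_map M J h (I +>\<^bsub>L\<^esub> a) = J +>\<^bsub>M\<^esub> h a" if "a \<in> carrier L" for a
    by (rule coset_map_rcoset[OF L.module_axioms M.module_axioms h sI sJ IJ that])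
  have hom: "coset_map M J h \<in> algebra_hom K (quot_algebra L I) (quot_algebra M J)"
    unfolding algebra_hom_def by (auto simp: qL qM cm hD)
  have im: "coset_map M J h ` carrier (quot_algebra L I) = carrier (quot_algebra M J)"
    by (simp add: qL(1) qM(1) image_image cm flip: surj)
  have inj: "inj_on (coset_map M J h) (carrier (quot_algebra L I)) \<longleftrightarrow>
      (\<forall>x\<in>carrier L. \<forall>y\<in>carrier L. h (x \<ominus>\<^bsub>L\<^esub> y) \<in> J \<longrightarrow> x \<ominus>\<^bsub>L\<^esub> y \<in> I)"
    by (simp add: qL(1) inj_on_def cm L.rcoset_eq_iff[OF sI] M.rcoset_eq_iff[OF sJ] hD
        algebra_hom_zero_diff[OF L.module_axioms M.module_axioms h])
  also have "\<dots> \<longleftrightarrow> {x \<in> carrier L. h x \<in> J} \<subseteq> I"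
  proof
    assume *: "\<forall>x\<in>carrier L. \<forall>y\<in>carrier L. h (x \<ominus>\<^bsub>L\<^esub> y) \<in> J \<longrightarrow> x \<ominus>\<^bsub>L\<^esub> y \<in> I"
    show "{x \<in> carrier L. h x \<in> J} \<subseteq> I"
      using bspec[OF bspec[OF *] L.M.zero_closed] by (auto simp: L.diff_zero)
  qed auto
  finally show ?thesis using hom im by (auto simp: algebra_iso_def bij_betw_def)
qed

lemma image_rcoset_in_kernel:
  assumes L: "module K L" and M: "module K M" and h: "h \<in> algebra_hom K L M"
    and J: "submodule J K L" and ker: "h ` J \<subseteq> {\<zero>\<^bsub>M\<^esub>}" and a: "a \<in> carrier L"
  shows "h ` (J +>\<^bsub>L\<^esub> a) = {h a}"
proof -
  interpret L: module K L by fact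
  interpret M: module K M by fact
  interpret J: abelian_subgroup J L by (rule L.submodule_abelian_subgroup[OF J])
  have "h (j \<oplus>\<^bsub>L\<^esub> a) = h a" if "j \<in> J" for j
    using that ker a J.a_subset by (auto simp: algebra_homD[OF h] subset_iff image_subset_iff)
  then show ?thesis using J.a_rcos_self[OF a] by (auto simp: a_r_coset_def')
qed

text \<open>
  The operations of the quotient are unions over all representatives, and \<open>h\<close> is constant on each
  coset of \<open>J\<close>. Evaluating \<open>h\<close> on such a union therefore shows that \<^const>\<open>theta_star\<close> is a
  homomorphism, for any submodule \<open>J\<close> on which \<open>h\<close> vanishes: the product of two cosets may be a union
  of several cosets, but \<open>h\<close> cannot tell them apart.
\<close>

lemma theta_star_iso_iff:
  assumes L: "nonassoc_algebra K L" and M: "nonassoc_algebra K M" and h: "h \<in> algebra_hom K L M"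
    and J: "submodule J K L" and ker: "h ` J \<subseteq> {\<zero>\<^bsub>M\<^esub>}"
    and S: "submodule S K L" and SN: "h ` S \<subseteq> N"
  shows "theta_star h \<in> algebra_iso K (quot_algebra (L\<lparr>carrier := S\<rparr>) J) (M\<lparr>carrier := N\<rparr>) \<longleftrightarrow>
    S \<inter> {x \<in> carrier L. h x = \<zero>\<^bsub>M\<^esub>} \<subseteq> J \<and> h ` S = N"
proof -
  interpret L: nonassoc_algebra K L by fact
  interpret M: nonassoc_algebra K M by fact
  interpret J: abelian_subgroup J L by (rule L.submodule_abelian_subgroup[OF J])
  note hD = algebra_homD[OF h]
  note hm = algebra_hom_zero_diff[OF L.module_axioms M.module_axioms h]
  let ?H = "quot_algebra (L\<lparr>carrier := S\<rparr>) J"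
  have coset: "J +>\<^bsub>L\<lparr>carrier := S\<rparr>\<^esub> x = J +>\<^bsub>L\<^esub> x" for x by (simp add: a_r_coset_def')
  have Sc: "x \<in> S \<Longrightarrow> x \<in> carrier L" for x using L.submoduleE(1)[OF S] by blast
  have carr: "carrier ?H = (\<lambda>x. J +>\<^bsub>L\<^esub> x) ` S"
    by (auto simp: quot_algebra_def A_RCOSETS_def' coset)
  note im = image_rcoset_in_kernel[OF L.module_axioms M.module_axioms h J ker]
  have th: "theta_star h (J +>\<^bsub>L\<^esub> a) = h a" if "a \<in> S" for a
    by (simp add: theta_star_def im[OF Sc[OF that]])
  have const: "theta_star h U = v" if "U \<noteq> {}" "\<And>x. x \<in> U \<Longrightarrow> h x = v" for U v
  proof -
    have "h ` U = {v}" using that by auto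
    then show ?thesis by (simp add: theta_star_def)
  qed
  have mem: "x \<in> carrier L" "h x = h b" if "x \<in> J +>\<^bsub>L\<^esub> b" "b \<in> carrier L" for x b
    using that im[OF that(2)] L.M.a_r_coset_subset_G[OF J.a_subset that(2)] by auto
  note self = J.a_rcos_self
  have hom: "theta_star h \<in> algebra_hom K ?H (M\<lparr>carrier := N\<rparr>)"
    unfolding algebra_hom_def
  proof (intro CollectI conjI ballI Pi_I, goal_cases)
    case (1 U) then show ?case using SN by (auto simp: carr th)
  next
    case (2 U V)
    then obtain a b where ab: "a \<in> S" "b \<in> S" "U = J +>\<^bsub>L\<^esub> a" "V = J +>\<^bsub>L\<^esub> b" by (auto simp: carr)
    have "theta_star h (U \<oplus>\<^bsub>?H\<^esub> V) = h a \<oplus>\<^bsub>M\<^esub> h b"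
    proof (rule const)
      show "U \<oplus>\<^bsub>?H\<^esub> V \<noteq> {}"
        using self[OF Sc[OF ab(1)]] self[OF Sc[OF ab(2)]] ab by (auto simp: quot_algebra_def set_add_def')
    qed (use ab mem Sc in \<open>auto simp: quot_algebra_def set_add_def' hD\<close>)
    then show ?case using ab th by simp
  next
    case (3 c U)
    then obtain a where a: "a \<in> S" "U = J +>\<^bsub>L\<^esub> a" by (auto simp: carr)
    have "theta_star h (c \<odot>\<^bsub>?H\<^esub> U) = c \<odot>\<^bsub>M\<^esub> h a"
    proof (rule const)
      show "c \<odot>\<^bsub>?H\<^esub> U \<noteq> {}"
        using self[OF Sc[OF a(1)]] self[of "c \<odot>\<^bsub>L\<^esub> a"] 3(1) a Sc
        by (auto simp: quot_algebra_def coset)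
      show "h x = c \<odot>\<^bsub>M\<^esub> h a" if x: "x \<in> c \<odot>\<^bsub>?H\<^esub> U" for x
      proof -
        obtain u where u: "u \<in> J +>\<^bsub>L\<^esub> a" "x \<in> J +>\<^bsub>L\<^esub> (c \<odot>\<^bsub>L\<^esub> u)"
          using x a by (auto simp: quot_algebra_def coset)
        then show ?thesis using mem[OF u(1) Sc[OF a(1)]] mem(2)[OF u(2)] 3(1) by (simp add: hD)
      qed
    qed
    then show ?case using a th by simp
  next
    case (4 U V)
    then obtain a b where ab: "a \<in> S" "b \<in> S" "U = J +>\<^bsub>L\<^esub> a" "V = J +>\<^bsub>L\<^esub> b" by (auto simp: carr)
    have "theta_star h (U \<otimes>\<^bsub>?H\<^esub> V) = h a \<otimes>\<^bsub>M\<^esub> h b"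
    proof (rule const)
      have "a \<otimes>\<^bsub>L\<^esub> b \<in> U \<otimes>\<^bsub>?H\<^esub> V"
        using self[OF Sc[OF ab(1)]] self[OF Sc[OF ab(2)]] self[of "a \<otimes>\<^bsub>L\<^esub> b"] ab Sc
        by (auto simp: quot_algebra_def rcoset_mult_def coset)
      then show "U \<otimes>\<^bsub>?H\<^esub> V \<noteq> {}" by blast
      show "h x = h a \<otimes>\<^bsub>M\<^esub> h b" if x: "x \<in> U \<otimes>\<^bsub>?H\<^esub> V" for x
      proof -
        obtain u v where uv: "u \<in> J +>\<^bsub>L\<^esub> a" "v \<in> J +>\<^bsub>L\<^esub> b" "x \<in> J +>\<^bsub>L\<^esub> (u \<otimes>\<^bsub>L\<^esub> v)"
          using x ab by (auto simp: quot_algebra_def rcoset_mult_def coset)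
        then show ?thesis
          using mem[OF uv(1) Sc[OF ab(1)]] mem[OF uv(2) Sc[OF ab(2)]] mem(2)[OF uv(3)] by (simp add: hD)
      qed
    qed
    then show ?case using ab th by simp
  qed
  have image: "theta_star h ` carrier ?H = h ` S"
    by (simp add: carr image_image th)
  have "inj_on (theta_star h) (carrier ?H) \<longleftrightarrow>
      (\<forall>x\<in>S. \<forall>y\<in>S. h x = h y \<longrightarrow> x \<ominus>\<^bsub>L\<^esub> y \<in> J)"
    by (auto simp: carr inj_on_def th L.rcoset_eq_iff[OF J] Sc)
  also have "\<dots> \<longleftrightarrow> S \<inter> {x \<in> carrier L. h x = \<zero>\<^bsub>M\<^esub>} \<subseteq> J"
  proof
    assume *: "\<forall>x\<in>S. \<forall>y\<in>S. h x = h y \<longrightarrow> x \<ominus>\<^bsub>L\<^esub> y \<in> J"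
    show "S \<inter> {x \<in> carrier L. h x = \<zero>\<^bsub>M\<^esub>} \<subseteq> J"
      using bspec[OF bspec[OF *] L.submodule_zero[OF S]] by (auto simp: L.diff_zero Sc hm)
  next
    assume *: "S \<inter> {x \<in> carrier L. h x = \<zero>\<^bsub>M\<^esub>} \<subseteq> J"
    have "x \<ominus>\<^bsub>L\<^esub> y \<in> J" if "x \<in> S" "y \<in> S" "h x = h y" for x y
      using that * L.submodule_minus[OF S that(1,2)] Sc hD(1)[of y]
      by (auto simp: hm M.M.r_neg a_minus_def[of M] subset_iff)
    then show "\<forall>x\<in>S. \<forall>y\<in>S. h x = h y \<longrightarrow> x \<ominus>\<^bsub>L\<^esub> y \<in> J" by blast
  qed
  finally show ?thesis using hom image by (auto simp: algebra_iso_def bij_betw_def)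
qed

section \<open>Stem covers\<close>

text \<open>
  Two elements with the same image under \<open>f\<close> differ by an element of the kernel. Since \<open>f\<close> maps the
  annihilator ideal of \<open>G\<close> onto that of \<open>Q\<close>, the preimage of the latter is the former plus the kernel.
\<close>

lemma liezation_iso_iff:
  assumes ext: "leibniz_extension K G Q f" and two: "\<one>\<^bsub>K\<^esub> \<oplus>\<^bsub>K\<^esub> \<one>\<^bsub>K\<^esub> \<in> Units K"
  shows "coset_map Q (leibniz_ann K Q) f \<in> algebra_iso K (liezation K G) (liezation K Q) \<longleftrightarrow>
    a_kernel G Q f \<subseteq> leibniz_ann K G"
proof -
  have f: "f \<in> algebra_hom K G Q" "f ` carrier G = carrier Q"
    using ext by (auto simp: leibniz_extension_def)
  interpret G: leibniz_algebra K G using ext by (simp add: leibniz_extension_def)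
  interpret Q: leibniz_algebra K Q using ext by (simp add: leibniz_extension_def)
  have ann: "f ` leibniz_ann K G = leibniz_ann K Q"
    using algebra_hom_lie_comm[OF G.nonassoc_algebra_axioms Q.nonassoc_algebra_axioms f(1), of "carrier G" "carrier G"]
    by (simp add: f(2) G.lie_comm_eq_leibniz_ann[OF two] Q.lie_comm_eq_leibniz_ann[OF two])
  note A = G.leibniz_ann_submodule
  have "{x \<in> carrier G. f x \<in> leibniz_ann K Q} \<subseteq> leibniz_ann K G \<longleftrightarrow> a_kernel G Q f \<subseteq> leibniz_ann K G"
  proof
    show "a_kernel G Q f \<subseteq> leibniz_ann K G" if "{x \<in> carrier G. f x \<in> leibniz_ann K Q} \<subseteq> leibniz_ann K G"
      using that Q.submodule_zero[OF Q.leibniz_ann_submodule] by (auto simp: a_kernel_def')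
  next
    assume ker: "a_kernel G Q f \<subseteq> leibniz_ann K G"
    show "{x \<in> carrier G. f x \<in> leibniz_ann K Q} \<subseteq> leibniz_ann K G"
    proof safe
      fix x assume x: "x \<in> carrier G" "f x \<in> leibniz_ann K Q"
      then obtain y where y: "y \<in> leibniz_ann K G" "f x = f y" by (auto simp flip: ann)
      have yc: "y \<in> carrier G" using y G.submoduleE(1)[OF A] by blast
      have "x \<ominus>\<^bsub>G\<^esub> y \<in> a_kernel G Q f"
        using x y(2) yc algebra_homD(1)[OF f(1) yc]
        by (simp add: a_kernel_def' algebra_hom_zero_diff[OF G.module_axioms Q.module_axioms f(1)]
            a_minus_def[of Q] Q.M.r_neg)
      then have "(x \<ominus>\<^bsub>G\<^esub> y) \<oplus>\<^bsub>G\<^esub> y \<in> leibniz_ann K G"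
        using ker y(1) G.submoduleE(5)[OF A] by blast
      then show "x \<in> leibniz_ann K G" using x yc by (simp add: a_minus_def G.M.a_assoc G.M.l_neg)
    qed
  qed
  then show ?thesis
    unfolding liezation_def
    using coset_map_iso_iff[OF G.nonassoc_algebra_axioms Q.nonassoc_algebra_axioms f
        G.leibniz_ann_ideal Q.leibniz_ann_ideal] ann by simp
qed

text \<open>
  The map sends the class of \<open>x\<close> to the coset of the same \<open>x\<close> modulo the larger submodule, which is zero
  exactly when \<open>x\<close> lies in that submodule.
\<close>

lemma HL2_Lie_map_zero_iff:
  assumes F: "nonassoc_algebra K F" and G: "nonassoc_algebra K G" and Q: "nonassoc_algebra K Q"
    and r: "\<rho> \<in> algebra_hom K F G" and f: "f \<in> algebra_hom K G Q"
  shows "(\<forall>A\<in>carrier (HL2_Lie K F G \<rho>). HL2_Lie_map K F \<rho> Q f A = \<zero>\<^bsub>HL2_Lie K F Q (f \<circ> \<rho>)\<^esub>) \<longleftrightarrow>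
    a_kernel F G \<rho> \<inter> lie_comm K F (carrier F) (carrier F)
      \<subseteq> lie_comm K F (a_kernel F Q (f \<circ> \<rho>)) (carrier F)"
proof -
  interpret F: nonassoc_algebra K F by fact
  interpret G: nonassoc_algebra K G by fact
  interpret Q: nonassoc_algebra K Q by fact
  let ?R = "a_kernel F G \<rho>" and ?S = "a_kernel F Q (f \<circ> \<rho>)"
  let ?I = "lie_comm K F ?R (carrier F)" and ?J = "lie_comm K F ?S (carrier F)"
  let ?D = "lie_comm K F (carrier F) (carrier F)"
  have RS: "?R \<subseteq> ?S" 
    using algebra_hom_zero_diff(1)[OF G.module_axioms Q.module_axioms f] by (auto simp: a_kernel_def')
  have Rc: "?R \<subseteq> carrier F" "?S \<subseteq> carrier F" by (auto simp: a_kernel_def')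
  have I: "submodule ?I K F" and J: "submodule ?J K F" using F.lie_comm_submodule Rc by auto
  interpret J: abelian_subgroup ?J F by (rule F.submodule_abelian_subgroup[OF J])
  have "?I \<subseteq> ?J"
    unfolding lie_comm_def using RS by (intro lin_span_mono) blast
  then have map: "HL2_Lie_map K F \<rho> Q f (?I +>\<^bsub>F\<^esub> a) = ?J +>\<^bsub>F\<^esub> a" if "a \<in> carrier F" for a
    unfolding HL2_Lie_map_def
    using coset_map_rcoset[OF F.module_axioms F.module_axioms algebra_hom_id I J _ that] by simp
  have "carrier (HL2_Lie K F G \<rho>) = (\<lambda>a. ?I +>\<^bsub>F\<^esub> a) ` (?R \<inter> ?D)"
    by (auto simp: HL2_Lie_def quot_algebra_def A_RCOSETS_def' a_r_coset_def')
  moreover have "\<zero>\<^bsub>HL2_Lie K F Q (f \<circ> \<rho>)\<^esub> = ?J" by (simp add: HL2_Lie_def quot_algebra_def)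
  moreover have "?J +>\<^bsub>F\<^esub> a = ?J \<longleftrightarrow> a \<in> ?J" if "a \<in> carrier F" for a
    using J.a_rcos_const[of a] J.a_rcos_self[OF that] by auto
  ultimately show ?thesis using Rc(1) map by (auto simp: subset_iff)
qed

theorem proposition3p13:
  fixes K :: "('k, 'c) ring_scheme"
    and G :: "('k, 'a, 'm) module_scheme" and Q :: "('k, 'b, 'n) module_scheme"
    and F :: "('k, 'f, 'l) module_scheme"
    and f :: "'a \<Rightarrow> 'b" and \<rho> :: "'f \<Rightarrow> 'a"
  assumes "field K" and "\<one>\<^bsub>K\<^esub> \<oplus>\<^bsub>K\<^esub> \<one>\<^bsub>K\<^esub> \<in> Units K"
    and "lie_central_extension K G Q f"
    and "free_presentation K F G \<rho>"
  shows "lie_stem_cover K F \<rho> G Q f \<longleftrightarrow>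
    theta_star \<rho> \<in> algebra_iso K (HL2_Lie K F Q (f \<circ> \<rho>)) (G\<lparr>carrier := a_kernel G Q f\<rparr>)"
proof -
  have ext: "leibniz_extension K G Q f" and cen: "lie_comm K G (a_kernel G Q f) (carrier G) = {\<zero>\<^bsub>G\<^esub>}"
    using assms(3) by (auto simp: lie_central_extension_def)
  have f: "f \<in> algebra_hom K G Q" "f ` carrier G = carrier Q"
    using ext by (auto simp: leibniz_extension_def)
  have r: "\<rho> \<in> algebra_hom K F G" "\<rho> ` carrier F = carrier G"
    using assms(4) by (auto simp: free_presentation_def leibniz_extension_def)
  interpret G: leibniz_algebra K G using ext by (simp add: leibniz_extension_def)
  interpret Q: leibniz_algebra K Q using ext by (simp add: leibniz_extension_def)
  interpret F: leibniz_algebra K F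
    using assms(4) by (simp add: free_presentation_def leibniz_extension_def)
  let ?n = "a_kernel G Q f" and ?r = "a_kernel F G \<rho>" and ?s = "a_kernel F Q (f \<circ> \<rho>)"
  let ?D = "lie_comm K F (carrier F) (carrier F)" and ?J = "lie_comm K F ?s (carrier F)"
  note lc = algebra_hom_lie_comm[OF F.nonassoc_algebra_axioms G.nonassoc_algebra_axioms r(1)]
  have sc: "?s \<subseteq> carrier F" by (auto simp: a_kernel_def')
  have D: "submodule ?D K F" and J: "submodule ?J K F"
    using sc by (auto intro: F.lie_comm_submodule)
  have Dc: "?D \<subseteq> carrier F" by (rule F.submoduleE(1)[OF D])
  have s: "submodule ?s K F"
  proof -
    have z: "submodule {\<zero>\<^bsub>Q\<^esub>} K Q" by (rule Q.submodule_if_closed) auto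
    show ?thesis
      using algebra_hom_preimage_submodule[OF F.module_axioms Q.module_axioms
          algebra_hom_compose[OF r(1) f(1)] z] by (simp add: a_kernel_def')
  qed
  have S: "submodule (?s \<inter> ?D) K F"
    using F.submoduleE[OF s] F.submoduleE[OF D] F.submodule_zero s D by (intro F.submodule_if_closed) auto
  (* Surjectivity of \<rho> gives the images of \<ss> and D; Lie-centrality enters through \<rho>J. *)
  have \<rho>s: "\<rho> ` ?s = ?n"
    by (auto simp: a_kernel_def' simp flip: r(2))
  have \<rho>D: "\<rho> ` ?D = leibniz_ann K G"
    using lc[of "carrier F" "carrier F"] by (simp add: r(2) G.lie_comm_eq_leibniz_ann[OF assms(2)])
  have \<rho>J: "\<rho> ` ?J = {\<zero>\<^bsub>G\<^esub>}"
    using lc[OF sc, of "carrier F"] by (simp add: r(2) \<rho>s cen)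
  (* An element of D that \<rho> maps into the kernel of f lies in the kernel of f \<circ> \<rho>. *)
  have "?s \<inter> ?D = {x \<in> ?D. \<rho> x \<in> ?n}"
    using Dc algebra_homD(1)[OF r(1)] by (simp add: a_kernel_def' subset_iff) blast
  then have \<rho>S: "\<rho> ` (?s \<inter> ?D) = ?n \<inter> leibniz_ann K G"
    unfolding \<rho>D[symmetric] by blast
  have rs: "?s \<inter> ?D \<inter> {x \<in> carrier F. \<rho> x = \<zero>\<^bsub>G\<^esub>} = ?r \<inter> ?D"
    using algebra_hom_zero_diff(1)[OF G.module_axioms Q.module_axioms f(1)]
    by (auto simp: a_kernel_def')
  have "theta_star \<rho> \<in> algebra_iso K (HL2_Lie K F Q (f \<circ> \<rho>)) (G\<lparr>carrier := ?n\<rparr>) \<longleftrightarrow>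
      ?r \<inter> ?D \<subseteq> ?J \<and> ?n \<subseteq> leibniz_ann K G"
    unfolding HL2_Lie_def
    using theta_star_iso_iff[OF F.nonassoc_algebra_axioms G.nonassoc_algebra_axioms r(1) J _ S, of ?n]
    by (auto simp: \<rho>J \<rho>S rs)
  then show ?thesis
    unfolding lie_stem_cover_def liezation_iso_iff[OF ext assms(2)]
      HL2_Lie_map_zero_iff[OF F.nonassoc_algebra_axioms G.nonassoc_algebra_axioms
        Q.nonassoc_algebra_axioms r(1) f(1)]
    using assms(3) by blast
qed

end
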